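(* Let $G$ be a finitely generated torsion-free nilpotent group that is strongly recurrent self-similar. Then $G$ is geometrically equivalent to its Malcev completion $G^{\ast}$.
   Context: For a finitely generated torsion-free nilpotent group $G$, $G^{\ast}$ denotes its Malcev completion: the (unique up to isomorphism over $G$) torsion-free nilpotent group containing $G$ in which every element has a unique $n$-th root for each $n \geq 1$ and in which every element has some positive power lying in $G$. A virtual endomorphism of a group $G$ is a homomorphism $f : K \to G$ from a subgroup $K \leqslant G$ of finite index into $G$. The $f$-core of $K$ is the largest subgroup $N \leqslant K$ which is normal in $G$ and $f$-invariant ($N^f \leqslant N$). The virtual endomorphism $f$ is simple if the $f$-core of $K$ is trivial. It is recurrent if $f : K \to G$ is surjective. A group $G$ is strongly recurrent self-similar if for every finite-index subgroup $H$ of $G$ there exist a finite-index subgroup $K$ of $H$ and a simple recurrent virtual endomorphism $f : K \to G$. Geometric equivalence: let $F$ be a free group of finite rank, $G$ a group and $S \subset F$ a subset. Put $\overline{S} = \{ \sigma \in \mathrm{Hom}(F,G) \mid S \subset \ker \sigma \}$ and $\overline{\overline{S}} = \bigcap_{\sigma \in \overline{S}} \ker \sigma$. The subset $S$ is called $G$-closed if $S = \overline{\overline{S}}$. Two groups $G_1$ and $G_2$ are geometrically equivalent if for every free group $F$ of finite rank and every subset $S$ of $F$, $S$ is $G_1$-closed if and only if $S$ is $G_2$-closed. *)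

theory Defs
  imports "HOL-Algebra.Generated_Groups"
begin

section \<open>Nilpotent groups and Malcev completions\<close>

definition finitely_generated :: "('a, 'm) monoid_scheme \<Rightarrow> bool" where
  "finitely_generated G \<longleftrightarrow>
     (\<exists>X. finite X \<and> X \<subseteq> carrier G \<and> generate G X = carrier G)"

definition torsion_free :: "('a, 'm) monoid_scheme \<Rightarrow> bool" where
  "torsion_free G \<longleftrightarrow>
     (\<forall>x\<in>carrier G. \<forall>n::nat. n \<ge> 1 \<longrightarrow> x [^]\<^bsub>G\<^esub> n = \<one>\<^bsub>G\<^esub> \<longrightarrow> x = \<one>\<^bsub>G\<^esub>)"

primrec lower_central_series :: "('a, 'm) monoid_scheme \<Rightarrow> nat \<Rightarrow> 'a set" where
  "lower_central_series G 0 = carrier G"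
| "lower_central_series G (Suc n) =
     generate G {x \<otimes>\<^bsub>G\<^esub> y \<otimes>\<^bsub>G\<^esub> inv\<^bsub>G\<^esub> x \<otimes>\<^bsub>G\<^esub> inv\<^bsub>G\<^esub> y | x y.
                   x \<in> lower_central_series G n \<and> y \<in> carrier G}"

definition nilpotent_group :: "('a, 'm) monoid_scheme \<Rightarrow> bool" where
  "nilpotent_group G \<longleftrightarrow> group G \<and> (\<exists>n. lower_central_series G n = {\<one>\<^bsub>G\<^esub>})"

text \<open>The completion contains \<open>G\<close> by way of an embedding \<open>\<iota>\<close>, so that the two groups may live
  on different types.  Being determined by these conditions up to isomorphism over \<open>G\<close>,
  it is described by a predicate.\<close>

definition malcev_completion :: "('a, 'm) monoid_scheme \<Rightarrow> ('b, 'n) monoid_scheme \<Rightarrow> bool" where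
  "malcev_completion G M \<longleftrightarrow>
     nilpotent_group M \<and> torsion_free M \<and>
     (\<forall>x\<in>carrier M. \<forall>n::nat. n \<ge> 1 \<longrightarrow> (\<exists>!y. y \<in> carrier M \<and> y [^]\<^bsub>M\<^esub> n = x)) \<and>
     (\<exists>\<iota>\<in>mon G M. \<forall>x\<in>carrier M. \<exists>n::nat. n \<ge> 1 \<and> x [^]\<^bsub>M\<^esub> n \<in> \<iota> ` carrier G)"


section \<open>Self-similarity\<close>

definition finite_index_subgroup :: "'a set \<Rightarrow> ('a, 'm) monoid_scheme \<Rightarrow> bool" where
  "finite_index_subgroup H G \<longleftrightarrow> subgroup H G \<and> finite (rcosets\<^bsub>G\<^esub> H)"

definition virtual_endomorphism ::
    "('a, 'm) monoid_scheme \<Rightarrow> 'a set \<Rightarrow> ('a \<Rightarrow> 'a) \<Rightarrow> bool" where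
  "virtual_endomorphism G K f \<longleftrightarrow>
     finite_index_subgroup K G \<and> f \<in> hom (G\<lparr>carrier := K\<rparr>) G"

definition f_core :: "('a, 'm) monoid_scheme \<Rightarrow> 'a set \<Rightarrow> ('a \<Rightarrow> 'a) \<Rightarrow> 'a set" where
  "f_core G K f = (GREATEST N. N \<subseteq> K \<and> N \<lhd> G \<and> f ` N \<subseteq> N)"

text \<open>The greatest such subgroup exists, so \<open>f_core\<close> is well defined.\<close>

lemma f_core_greatest:
  assumes G: "group G" and vf: "virtual_endomorphism G K f"
  shows "f_core G K f \<subseteq> K \<and> f_core G K f \<lhd> G \<and> f ` f_core G K f \<subseteq> f_core G K f"
    and "\<And>N. N \<subseteq> K \<Longrightarrow> N \<lhd> G \<Longrightarrow> f ` N \<subseteq> N \<Longrightarrow> N \<subseteq> f_core G K f"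
proof -
  interpret group G by (rule G)
  define P where "P = (\<lambda>N. N \<subseteq> K \<and> N \<lhd> G \<and> f ` N \<subseteq> N)"
  have K: "subgroup K G" and f: "f \<in> hom (G\<lparr>carrier := K\<rparr>) G"
    using vf by (auto simp: virtual_endomorphism_def finite_index_subgroup_def)
  define U where "U = \<Union> (Collect P)"
  have UK: "U \<subseteq> K" by (auto simp: U_def P_def)
  have Uc: "U \<subseteq> carrier G" using UK subgroup.subset[OF K] by blast
  have gK: "generate G U \<subseteq> K" by (rule generate_subgroup_incl[OF UK K])
  have norm: "generate G U \<lhd> G"
  proof (rule normal_generateI[OF Uc])
    fix h g assume "h \<in> U" "g \<in> carrier G"
    then obtain N where "P N" "h \<in> N" by (auto simp: U_def)
    then show "g \<otimes>\<^bsub>G\<^esub> h \<otimes>\<^bsub>G\<^esub> inv\<^bsub>G\<^esub> g \<in> U"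
      using \<open>g \<in> carrier G\<close> unfolding U_def P_def normal_inv_iff by blast
  qed
  interpret K: group "G\<lparr>carrier := K\<rparr>" by (rule subgroup_imp_group[OF K])
  interpret f: group_hom "G\<lparr>carrier := K\<rparr>" G f
    by (unfold_locales) (rule f)
  have fU: "f ` U \<subseteq> U" by (auto simp: U_def P_def)
  have inv: "f x \<in> generate G U" if "x \<in> generate G U" for x
    using that
  proof (induction rule: generate.induct)
    case one
    then show ?case using f.hom_one by (simp add: generate.one)
  next
    case (incl h)
    then show ?case using fU by (auto intro: generate.incl)
  next
    case (inv h)
    then have hK: "h \<in> K" using UK by auto
    then have "f (inv\<^bsub>G\<^esub> h) = inv\<^bsub>G\<^esub> (f h)"
      using f.hom_inv[of h] m_inv_consistent[OF K hK] by simp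
    then show ?case using fU inv by (auto intro: generate.inv)
  next
    case (eng h1 h2)
    then have "h1 \<in> K" "h2 \<in> K" using gK by auto
    then have "f (h1 \<otimes>\<^bsub>G\<^esub> h2) = f h1 \<otimes>\<^bsub>G\<^esub> f h2" using f.hom_mult[of h1 h2] by simp
    then show ?case using eng by (auto intro: generate.eng)
  qed
  have PU: "P (generate G U)" using gK norm inv by (auto simp: P_def)
  have ge: "N \<subseteq> generate G U" if "P N" for N
    using that by (auto simp: U_def intro: generate.incl)
  have eq: "f_core G K f = generate G U"
    unfolding f_core_def using Greatest_equality[of P, OF PU ge] by (simp add: P_def)
  show "f_core G K f \<subseteq> K \<and> f_core G K f \<lhd> G \<and> f ` f_core G K f \<subseteq> f_core G K f"
    using PU by (simp add: eq P_def)
  show "\<And>N. N \<subseteq> K \<Longrightarrow> N \<lhd> G \<Longrightarrow> f ` N \<subseteq> N \<Longrightarrow> N \<subseteq> f_core G K f"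
    using ge by (simp add: eq P_def)
qed

definition simple_virtual_endomorphism ::
    "('a, 'm) monoid_scheme \<Rightarrow> 'a set \<Rightarrow> ('a \<Rightarrow> 'a) \<Rightarrow> bool" where
  "simple_virtual_endomorphism G K f \<longleftrightarrow>
     virtual_endomorphism G K f \<and> f_core G K f = {\<one>\<^bsub>G\<^esub>}"

definition recurrent_virtual_endomorphism ::
    "('a, 'm) monoid_scheme \<Rightarrow> 'a set \<Rightarrow> ('a \<Rightarrow> 'a) \<Rightarrow> bool" where
  "recurrent_virtual_endomorphism G K f \<longleftrightarrow>
     virtual_endomorphism G K f \<and> f ` K = carrier G"

definition strongly_recurrent_self_similar :: "('a, 'm) monoid_scheme \<Rightarrow> bool" where
  "strongly_recurrent_self_similar G \<longleftrightarrow>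
     (\<forall>H. finite_index_subgroup H G \<longrightarrow>
        (\<exists>K f. finite_index_subgroup K (G\<lparr>carrier := H\<rparr>) \<and>
               simple_virtual_endomorphism G K f \<and>
               recurrent_virtual_endomorphism G K f))"


section \<open>Free groups\<close>

text \<open>A letter is a generator paired with a sign, \<open>False\<close> marking a formal inverse.  Elements of
  the free group are the reduced words.\<close>

definition inv_letter :: "'x \<times> bool \<Rightarrow> 'x \<times> bool" where
  "inv_letter l = (fst l, \<not> snd l)"

fun push :: "'x \<times> bool \<Rightarrow> ('x \<times> bool) list \<Rightarrow> ('x \<times> bool) list" where
  "push l [] = [l]"
| "push l (m # w) = (if m = inv_letter l then w else l # m # w)"

definition reduced :: "('x \<times> bool) list \<Rightarrow> bool" where
  "reduced w \<longleftrightarrow> (\<forall>i. Suc i < length w \<longrightarrow> w ! Suc i \<noteq> inv_letter (w ! i))"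

definition free_group :: "'x set \<Rightarrow> ('x \<times> bool) list monoid" where
  "free_group X =
     \<lparr>carrier = {w. fst ` set w \<subseteq> X \<and> reduced w},
      mult = (\<lambda>u v. foldr push u v),
      one = []\<rparr>"

lemma inv_letter_simps [simp]:
  "inv_letter (inv_letter l) = l" "inv_letter l \<noteq> l" "l \<noteq> inv_letter l"
  "fst (inv_letter l) = fst l" "inv_letter l = inv_letter m \<longleftrightarrow> l = m"
  by (auto simp: inv_letter_def prod_eq_iff)

lemma reduced_Nil [simp]: "reduced []"
  by (simp add: reduced_def)

lemma reduced_single [simp]: "reduced [l]"
  by (simp add: reduced_def)

lemma reduced_Cons2 [simp]: "reduced (l # m # w) \<longleftrightarrow> m \<noteq> inv_letter l \<and> reduced (m # w)"
  unfolding reduced_def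
  by (auto simp: nth_Cons split: nat.splits)

lemma reduced_ConsD: "reduced (l # w) \<Longrightarrow> reduced w"
  by (cases w) auto

lemma reduced_push: "reduced w \<Longrightarrow> reduced (push l w)"
  by (cases w) (auto dest: reduced_ConsD)

lemma reduced_foldr_push: "reduced v \<Longrightarrow> reduced (foldr push u v)"
  by (induction u) (auto intro: reduced_push)

lemma push_inverse: "reduced w \<Longrightarrow> push l (push (inv_letter l) w) = w"
proof (cases w)
  case (Cons m v)
  assume "reduced w"
  with Cons show ?thesis by (cases v) auto
qed simp

lemma push_reduced: "reduced (l # w) \<Longrightarrow> push l w = l # w"
  by (cases w) auto

lemma foldr_push_Nil: "reduced w \<Longrightarrow> foldr push w [] = w"
proof (induction w)
  case (Cons l w)
  then show ?case using push_reduced[of l w] reduced_ConsD[of l w] by simp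
qed simp

lemma foldr_push_push:
  assumes "reduced w"
  shows "foldr push (push l u) w = push l (foldr push u w)"
proof (cases u)
  case (Cons m v)
  then show ?thesis
    using push_inverse[OF reduced_foldr_push[OF assms], of l v] by auto
qed simp

lemma foldr_push_assoc:
  "reduced w \<Longrightarrow> foldr push (foldr push u v) w = foldr push u (foldr push v w)"
  by (induction u) (simp_all add: foldr_push_push)

lemma set_push: "fst ` set (push l w) \<subseteq> insert (fst l) (fst ` set w)"
  by (cases w) auto

lemma set_foldr_push: "fst ` set (foldr push u v) \<subseteq> fst ` set u \<union> fst ` set v"
proof (induction u)
  case (Cons l u)
  then show ?case using set_push[of l "foldr push u v"] by (simp, blast)
qed simp

lemma foldr_push_left_inverse:
  "reduced v \<Longrightarrow> foldr push (map inv_letter (rev u)) (foldr push u v) = v"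
proof (induction u)
  case (Cons l u)
  then show ?case
    using push_inverse[OF reduced_foldr_push, of v "inv_letter l" u] by simp
qed simp

lemma group_free_group: "group (free_group X)"
proof (rule groupI)
  fix u assume u: "u \<in> carrier (free_group X)"
  let ?v = "foldr push (map inv_letter (rev u)) []"
  have "?v \<in> carrier (free_group X)"
    using u set_foldr_push[of "map inv_letter (rev u)" "[]"]
    by (auto simp: free_group_def reduced_foldr_push image_image)
  moreover have "foldr push ?v u = []"
    using u foldr_push_left_inverse[of "[]" u]
    by (simp add: free_group_def foldr_push_assoc foldr_push_Nil)
  ultimately show "\<exists>v\<in>carrier (free_group X). v \<otimes>\<^bsub>free_group X\<^esub> u = \<one>\<^bsub>free_group X\<^esub>"
    by (auto simp: free_group_def)
next
  fix u v assume "u \<in> carrier (free_group X)" "v \<in> carrier (free_group X)"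
  then show "u \<otimes>\<^bsub>free_group X\<^esub> v \<in> carrier (free_group X)"
    using subset_trans[OF set_foldr_push[of u v], of X]
    by (simp add: free_group_def reduced_foldr_push)
qed (auto simp: free_group_def foldr_push_assoc)

lemma free_group_universal:
  assumes G: "group G" and h: "h ` X \<subseteq> carrier G"
  shows "\<exists>\<phi>\<in>hom (free_group X) G. \<forall>x\<in>X. \<phi> [(x, True)] = h x"
    and "\<And>\<phi> \<psi> w. \<lbrakk>\<phi> \<in> hom (free_group X) G; \<psi> \<in> hom (free_group X) G;
           \<forall>x\<in>X. \<phi> [(x, True)] = \<psi> [(x, True)]; w \<in> carrier (free_group X)\<rbrakk>
           \<Longrightarrow> \<phi> w = \<psi> w"
proof -
  interpret G: group G by (rule G)
  interpret F: group "free_group X" by (rule group_free_group)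
  define e where "e l = (if snd l then h (fst l) else inv\<^bsub>G\<^esub> h (fst l))" for l
  define \<phi> where "\<phi> w = foldr (\<lambda>l y. e l \<otimes>\<^bsub>G\<^esub> y) w \<one>\<^bsub>G\<^esub>" for w
  have e: "e l \<in> carrier G" if "fst l \<in> X" for l using h that by (auto simp: e_def)
  have ei: "e l \<otimes>\<^bsub>G\<^esub> e (inv_letter l) = \<one>\<^bsub>G\<^esub>" if "fst l \<in> X" for l
  proof -
    have "h (fst l) \<in> carrier G" using h that by auto
    then show ?thesis by (simp add: e_def inv_letter_def)
  qed
  have c: "\<phi> w \<in> carrier G" if "fst ` set w \<subseteq> X" for w
    using that by (induction w) (auto simp: \<phi>_def e)
  have p: "\<phi> (push l w) = e l \<otimes>\<^bsub>G\<^esub> \<phi> w" if "fst l \<in> X" "fst ` set w \<subseteq> X" for l w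
  proof (cases w)
    case Nil then show ?thesis by (simp add: \<phi>_def)
  next
    case (Cons m v)
    have *: "e l \<otimes>\<^bsub>G\<^esub> (e (inv_letter l) \<otimes>\<^bsub>G\<^esub> \<phi> v) = \<phi> v"
      using ei[OF that(1)] e[of l] e[of "inv_letter l"] c[of v] that Cons
      by (simp add: G.m_assoc[symmetric])
    show ?thesis
    proof (cases "m = inv_letter l")
      case True
      then show ?thesis using * Cons by (simp add: \<phi>_def)
    next
      case False
      then show ?thesis using Cons by (simp add: \<phi>_def)
    qed
  qed
  have m: "\<phi> (foldr push u v) = \<phi> u \<otimes>\<^bsub>G\<^esub> \<phi> v"
    if "fst ` set u \<subseteq> X" "fst ` set v \<subseteq> X" for u v
    using that(1)
  proof (induction u)
    case Nil then show ?case using c[OF that(2)] by (simp add: \<phi>_def)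
  next
    case (Cons l u)
    have "fst ` set (foldr push u v) \<subseteq> X"
      using Cons.prems that(2) subset_trans[OF set_foldr_push[of u v], of X] by simp
    moreover have "\<phi> (l # u) = e l \<otimes>\<^bsub>G\<^esub> \<phi> u" by (simp add: \<phi>_def)
    ultimately show ?case using Cons p[of l "foldr push u v"] e[of l] c[of u] c[OF that(2)]
      by (simp add: G.m_assoc)
  qed
  have "\<phi> \<in> hom (free_group X) G"
    using c m by (auto simp: hom_def free_group_def)
  moreover have "\<phi> [(x, True)] = h x" if "x \<in> X" for x
    using h that by (auto simp: \<phi>_def e_def)
  ultimately show "\<exists>\<phi>\<in>hom (free_group X) G. \<forall>x\<in>X. \<phi> [(x, True)] = h x" by blast
next
  fix \<phi> \<psi> w
  assume a: "\<phi> \<in> hom (free_group X) G" "\<psi> \<in> hom (free_group X) G"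
    "\<forall>x\<in>X. \<phi> [(x, True)] = \<psi> [(x, True)]" "w \<in> carrier (free_group X)"
  interpret G: group G by (rule G)
  interpret F: group "free_group X" by (rule group_free_group)
  interpret p: group_hom "free_group X" G \<phi> by unfold_locales (rule a(1))
  interpret q: group_hom "free_group X" G \<psi> by unfold_locales (rule a(2))
  have lc: "[l] \<in> carrier (free_group X)" if "fst l \<in> X" for l
    using that by (simp add: free_group_def)
  have le: "\<phi> [l] = \<psi> [l]" if "fst l \<in> X" for l
  proof (cases "snd l")
    case True
    then have "l = (fst l, True)" by (simp add: prod_eq_iff)
    then show ?thesis using a(3) that by metis
  next
    case False
    then have l: "l = (fst l, False)" by (simp add: prod_eq_iff)
    have "[l] \<otimes>\<^bsub>free_group X\<^esub> [(fst l, True)] = \<one>\<^bsub>free_group X\<^esub>"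
      using False by (simp add: free_group_def inv_letter_def)
    then have "[l] = inv\<^bsub>free_group X\<^esub> [(fst l, True)]"
      using F.inv_equality[of "[l]" "[(fst l, True)]"] lc[OF that] lc[of "(fst l, True)"] that by simp
    then show ?thesis using a(3) that lc[of "(fst l, True)"] by simp
  qed
  have "fst ` set w \<subseteq> X \<Longrightarrow> reduced w \<Longrightarrow> \<phi> w = \<psi> w" for w
  proof (induction w)
    case Nil
    then show ?case using p.hom_one q.hom_one by (simp add: free_group_def)
  next
    case (Cons l w)
    have w: "reduced w" "fst ` set w \<subseteq> X" using Cons.prems by (auto dest: reduced_ConsD)
    have "l # w = [l] \<otimes>\<^bsub>free_group X\<^esub> w"
      using push_reduced[OF Cons.prems(2)] by (simp add: free_group_def)
    moreover have "w \<in> carrier (free_group X)" using w by (simp add: free_group_def)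
    moreover have "fst l \<in> X" using Cons.prems(1) by simp
    ultimately show ?case
      using Cons.IH[OF w(2,1)] le[of l] lc[of l] by simp
  qed
  then show "\<phi> w = \<psi> w" using a(4) by (simp add: free_group_def)
qed


section \<open>Geometric equivalence\<close>

definition annihilating_homs ::
    "('f, 'k) monoid_scheme \<Rightarrow> ('a, 'm) monoid_scheme \<Rightarrow> 'f set \<Rightarrow> ('f \<Rightarrow> 'a) set" where
  "annihilating_homs F G S = {\<sigma> \<in> hom F G. S \<subseteq> kernel F G \<sigma>}"

definition G_closure ::
    "('f, 'k) monoid_scheme \<Rightarrow> ('a, 'm) monoid_scheme \<Rightarrow> 'f set \<Rightarrow> 'f set" where
  "G_closure F G S = (\<Inter>\<sigma>\<in>annihilating_homs F G S. kernel F G \<sigma>)"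

definition G_closed ::
    "('f, 'k) monoid_scheme \<Rightarrow> ('a, 'm) monoid_scheme \<Rightarrow> 'f set \<Rightarrow> bool" where
  "G_closed F G S \<longleftrightarrow> S = G_closure F G S"

text \<open>Every free group of rank \<open>n\<close> is isomorphic to \<open>free_group {..<n}\<close>, and being closed is
  invariant under isomorphisms of \<open>F\<close>, so it is enough to consider these models.\<close>

definition geometrically_equivalent ::
    "('a, 'm) monoid_scheme \<Rightarrow> ('b, 'n) monoid_scheme \<Rightarrow> bool" where
  "geometrically_equivalent G\<^sub>1 G\<^sub>2 \<longleftrightarrow>
     (\<forall>n::nat. \<forall>S \<subseteq> carrier (free_group {..<n}).
        G_closed (free_group {..<n}) G\<^sub>1 S \<longleftrightarrow> G_closed (free_group {..<n}) G\<^sub>2 S)"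

end

theory Submission
  imports Defs
begin

text \<open>Composing with the embedding \<open>\<iota>\<close> of \<open>G\<close> into \<open>M\<close> turns homomorphisms \<open>F \<rightarrow> G\<close> into
  homomorphisms \<open>F \<rightarrow> M\<close> with the same kernel, so it suffices to find, for every
  \<open>\<sigma> : F \<rightarrow> M\<close>, some \<open>\<tau> : F \<rightarrow> G\<close> with the same kernel.  Choose \<open>q\<close> such that all
  \<open>\<sigma>(x\<^sub>i)\<^sup>q\<close> lie in \<open>\<iota>(G)\<close>.  In class \<open>c\<close> every element of the subgroup \<open>H\<close> generated by the
  \<open>q\<^sup>c\<close>-th powers is a \<open>q\<close>-th power, and \<open>H\<close> has finite index.  Self-similarity gives \<open>K \<le> H\<close> and a
  surjective simple \<open>f : K \<rightarrow> G\<close>, which is injective.  Now \<open>\<sigma>(x\<^sub>i)\<^sup>q = \<iota>(f(y\<^sub>i\<^sup>q))\<close> for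
  suitable \<open>y\<^sub>i \<in> G\<close>, and \<open>\<tau>(x\<^sub>i) = y\<^sub>i\<close> works: the elements
  \<open>(\<sigma>(x\<^sub>i), y\<^sub>i)\<close> of the nilpotent group \<open>M \<times> G\<close> have a power in the graph of the injective map
  \<open>\<iota> \<circ> f\<close>, hence so does every \<open>(\<sigma>(w), \<tau>(w))\<close>, and torsion-freeness gives
  \<open>\<sigma>(w) = 1 \<longleftrightarrow> \<tau>(w) = 1\<close>.\<close>

section \<open>Commutator calculus along the lower central series\<close>

section \<open>Commutators and the lower central series\<close>

definition commutator :: "('a, 'm) monoid_scheme \<Rightarrow> 'a \<Rightarrow> 'a \<Rightarrow> 'a" where
  "commutator G x y = x \<otimes>\<^bsub>G\<^esub> y \<otimes>\<^bsub>G\<^esub> inv\<^bsub>G\<^esub> x \<otimes>\<^bsub>G\<^esub> inv\<^bsub>G\<^esub> y"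

text \<open>Folds the recursive clause into \<open>commutator\<close>; the raw clause then leaves
  the simpset, so that the terms of the series stay folded.\<close>

lemma lower_central_series_Suc:
  "lower_central_series G (Suc n) =
     generate G {commutator G x y | x y. x \<in> lower_central_series G n \<and> y \<in> carrier G}"
  by (simp add: commutator_def)

declare lower_central_series.simps(2) [simp del]

context group
begin

lemma m_inv_cancel: "\<lbrakk>x \<in> carrier G; y \<in> carrier G\<rbrakk> \<Longrightarrow> x \<otimes> (inv x \<otimes> y) = y"
  by (simp add: m_assoc [symmetric])

lemma inv_m_cancel: "\<lbrakk>x \<in> carrier G; y \<in> carrier G\<rbrakk> \<Longrightarrow> inv x \<otimes> (x \<otimes> y) = y"
  by (simp add: m_assoc [symmetric])

text \<open>Together with the default rules for units and inverses, these form the complete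
  rewriting system for groups, so word identities reduce to simplification.\<close>

lemmas group_simps = m_assoc m_inv_cancel inv_m_cancel inv_mult_group

lemma commutator_closed [simp]:
  "\<lbrakk>x \<in> carrier G; y \<in> carrier G\<rbrakk> \<Longrightarrow> commutator G x y \<in> carrier G"
  by (simp add: commutator_def)

lemma mult_eq_commutator_mult:
  "\<lbrakk>x \<in> carrier G; y \<in> carrier G\<rbrakk> \<Longrightarrow> x \<otimes> y = commutator G x y \<otimes> (y \<otimes> x)"
  by (simp add: commutator_def group_simps)

text \<open>Here and in the next identity the commutator is multiplicative up to a conjugation and
  the order of factors, both of which disappear modulo a suitable term of the series.\<close>

lemma commutator_mult_left:
  "\<lbrakk>x \<in> carrier G; y \<in> carrier G; z \<in> carrier G\<rbrakk>
    \<Longrightarrow> commutator G (x \<otimes> y) z = x \<otimes> commutator G y z \<otimes> inv x \<otimes> commutator G x z"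
  by (simp add: commutator_def group_simps)

lemma commutator_mult_right:
  "\<lbrakk>x \<in> carrier G; y \<in> carrier G; z \<in> carrier G\<rbrakk>
    \<Longrightarrow> commutator G x (y \<otimes> z) = commutator G x y \<otimes> (y \<otimes> commutator G x z \<otimes> inv y)"
  by (simp add: commutator_def group_simps)

lemma commutator_conj:
  "\<lbrakk>x \<in> carrier G; y \<in> carrier G; g \<in> carrier G\<rbrakk>
    \<Longrightarrow> g \<otimes> commutator G x y \<otimes> inv g
      = commutator G (g \<otimes> x \<otimes> inv g) (g \<otimes> y \<otimes> inv g)"
  by (simp add: commutator_def group_simps)

text \<open>Conjugation acts on both entries of a commutator, and the first entry stays in the
  previous term by induction; so the generating set is closed under conjugation.\<close>

lemma lower_central_series_normal: "lower_central_series G n \<lhd> G"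
proof (induction n)
  case 0
  then show ?case by (simp add: normal_self)
next
  case (Suc n)
  interpret N: normal "lower_central_series G n" G by (rule Suc.IH)
  show ?case unfolding lower_central_series_Suc
  proof (rule normal_generateI)
    show "{commutator G x y |x y. x \<in> lower_central_series G n \<and> y \<in> carrier G} \<subseteq> carrier G"
      by (auto intro: commutator_closed)
    fix h g
    assume h: "h \<in> {commutator G x y |x y. x \<in> lower_central_series G n \<and> y \<in> carrier G}"
      and g: "g \<in> carrier G"
    from h obtain x y where xy: "h = commutator G x y" "x \<in> lower_central_series G n" "y \<in> carrier G"
      by blast
    have "g \<otimes> h \<otimes> inv g = commutator G (g \<otimes> x \<otimes> inv g) (g \<otimes> y \<otimes> inv g)"
      using xy g by (simp add: commutator_conj)
    moreover have "g \<otimes> x \<otimes> inv g \<in> lower_central_series G n"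
      using xy(2) g N.inv_op_closed2 by blast
    moreover have "g \<otimes> y \<otimes> inv g \<in> carrier G" using xy(3) g by simp
    ultimately show
      "g \<otimes> h \<otimes> inv g \<in> {commutator G x y |x y. x \<in> lower_central_series G n \<and> y \<in> carrier G}"
      by blast
  qed
qed

lemma lower_central_series_subgroup: "subgroup (lower_central_series G n) G"
  by (rule normal_imp_subgroup[OF lower_central_series_normal])

lemma lower_central_series_in_carrier: "x \<in> lower_central_series G n \<Longrightarrow> x \<in> carrier G"
  using subgroup.subset[OF lower_central_series_subgroup] by blast

lemma commutator_in_lower_central_series:
  "\<lbrakk>x \<in> lower_central_series G n; y \<in> carrier G\<rbrakk>
    \<Longrightarrow> commutator G x y \<in> lower_central_series G (Suc n)"
  unfolding lower_central_series_Suc by (auto intro: generate.incl)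

lemma lower_central_series_Suc_subset:
  "lower_central_series G (Suc n) \<subseteq> lower_central_series G n"
  unfolding lower_central_series_Suc
proof (rule generate_subgroup_incl[OF _ lower_central_series_subgroup], clarify)
  fix x y assume x: "x \<in> lower_central_series G n" and y: "y \<in> carrier G"
  interpret N: normal "lower_central_series G n" G by (rule lower_central_series_normal)
  \<comment> \<open>The commutator is \<open>x\<close> times a conjugate of \<open>inv x\<close>,
    and the term is normal.\<close>
  have "commutator G x y = x \<otimes> (y \<otimes> inv x \<otimes> inv y)"
    using x y by (simp add: commutator_def m_assoc)
  then show "commutator G x y \<in> lower_central_series G n"
    using x y N.inv_op_closed2[of y "inv x"] by simp
qed

lemma lower_central_series_antimono:
  "m \<le> n \<Longrightarrow> lower_central_series G n \<subseteq> lower_central_series G m"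
  by (rule lift_Suc_antimono_le[of "lower_central_series G"]) (rule lower_central_series_Suc_subset)

section \<open>Bilinearity of the commutator modulo the next term but one\<close>

lemma lower_central_series_coset_commute:
  assumes "x \<in> lower_central_series G n" "y \<in> carrier G"
  shows "lower_central_series G (Suc n) #> (x \<otimes> y) = lower_central_series G (Suc n) #> (y \<otimes> x)"
proof -
  have x: "x \<in> carrier G" using assms(1) by (rule lower_central_series_in_carrier)
  \<comment> \<open>The two products differ by their commutator, which lies in the next term: term
    \<open>n\<close> is central modulo term \<open>Suc n\<close>.\<close>
  have "x \<otimes> y \<in> lower_central_series G (Suc n) #> (y \<otimes> x)"
    using mult_eq_commutator_mult[OF x assms(2)] commutator_in_lower_central_series[OF assms]
    unfolding r_coset_def by blast
  then show ?thesis
    using repr_independence[OF _ _ lower_central_series_subgroup] x assms(2) by simp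
qed

lemma normal_coset_conj_central:
  assumes "N \<lhd> G" "x \<in> carrier G" "y \<in> carrier G" "N #> (x \<otimes> y) = N #> (y \<otimes> x)"
  shows "N #> (y \<otimes> x \<otimes> inv y) = N #> x"
proof -
  interpret N: normal N G by (rule assms(1))
  have "N #> (y \<otimes> x \<otimes> inv y) = (N #> (y \<otimes> x)) <#> (N #> inv y)"
    using assms by (simp add: N.rcos_sum)
  also have "\<dots> = N #> (x \<otimes> y \<otimes> inv y)"
    using assms by (simp add: N.rcos_sum flip: assms(4))
  finally show ?thesis using assms by (simp add: m_assoc)
qed

text \<open>Expanding the product leaves \<open>commutator G u z\<close> conjugated by
  \<open>y\<close>. That commutator lies in term \<open>Suc n\<close>, which is central modulo
  \<open>Suc (Suc n)\<close>, so the conjugation has no effect.\<close>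

lemma commutator_hom_right:
  assumes u: "u \<in> lower_central_series G n"
  shows "(\<lambda>y. lower_central_series G (Suc (Suc n)) #> commutator G u y)
      \<in> hom G (G Mod lower_central_series G (Suc (Suc n)))"
proof (rule homI)
  let ?N = "lower_central_series G (Suc (Suc n))"
  interpret N: normal ?N G by (rule lower_central_series_normal)
  have uc: "u \<in> carrier G" using u by (rule lower_central_series_in_carrier)
  fix y assume y: "y \<in> carrier G"
  show "?N #> commutator G u y \<in> carrier (G Mod ?N)"
    using uc y by (auto simp: FactGroup_def RCOSETS_def)
  fix z assume z: "z \<in> carrier G"
  have "?N #> commutator G u (y \<otimes> z)
      = (?N #> commutator G u y) <#> (?N #> (y \<otimes> commutator G u z \<otimes> inv y))"
    using uc y z by (simp add: commutator_mult_right N.rcos_sum)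
  also have "?N #> (y \<otimes> commutator G u z \<otimes> inv y) = ?N #> commutator G u z"
    by (rule normal_coset_conj_central[OF lower_central_series_normal])
      (use uc y z lower_central_series_coset_commute[OF commutator_in_lower_central_series[OF u z] y]
        in auto)
  finally show "?N #> commutator G u (y \<otimes> z)
      = (?N #> commutator G u y) \<otimes>\<^bsub>G Mod ?N\<^esub> (?N #> commutator G u z)"
    by (simp add: FactGroup_def)
qed

lemma commutator_hom_left:
  assumes y: "y \<in> carrier G"
  shows "(\<lambda>u. lower_central_series G (Suc (Suc n)) #> commutator G u y)
      \<in> hom (G\<lparr>carrier := lower_central_series G n\<rparr>) (G Mod lower_central_series G (Suc (Suc n)))"
proof (rule homI)
  let ?N = "lower_central_series G (Suc (Suc n))"
  interpret N: normal ?N G by (rule lower_central_series_normal)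
  fix u assume "u \<in> carrier (G\<lparr>carrier := lower_central_series G n\<rparr>)"
  then have u: "u \<in> lower_central_series G n" by simp
  then have uc: "u \<in> carrier G" by (rule lower_central_series_in_carrier)
  show "?N #> commutator G u y \<in> carrier (G Mod ?N)"
    using uc y by (auto simp: FactGroup_def RCOSETS_def)
  fix v assume "v \<in> carrier (G\<lparr>carrier := lower_central_series G n\<rparr>)"
  then have v: "v \<in> lower_central_series G n" by simp
  then have vc: "v \<in> carrier G" by (rule lower_central_series_in_carrier)
  have "?N #> commutator G (u \<otimes> v) y
      = (?N #> (u \<otimes> commutator G v y \<otimes> inv u)) <#> (?N #> commutator G u y)"
    using uc y vc by (simp add: commutator_mult_left N.rcos_sum)
  also have "?N #> (u \<otimes> commutator G v y \<otimes> inv u) = ?N #> commutator G v y"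
    by (rule normal_coset_conj_central[OF lower_central_series_normal])
      (use uc y vc lower_central_series_coset_commute[OF commutator_in_lower_central_series[OF v y] uc]
        in auto)
  \<comment> \<open>Expansion on the left yields the factors in the opposite order; they commute in
    the quotient by the same centrality.\<close>
  also have "(?N #> commutator G v y) <#> (?N #> commutator G u y)
      = ?N #> (commutator G u y \<otimes> commutator G v y)"
    using uc vc y
      lower_central_series_coset_commute[OF commutator_in_lower_central_series[OF v y],
        of "commutator G u y"]
    by (simp add: N.rcos_sum)
  also have "\<dots> = (?N #> commutator G u y) <#> (?N #> commutator G v y)"
    using uc vc y by (simp add: N.rcos_sum)
  finally show "?N #> commutator G (u \<otimes>\<^bsub>G\<lparr>carrier := lower_central_series G n\<rparr>\<^esub> v) y
      = (?N #> commutator G u y) \<otimes>\<^bsub>G Mod ?N\<^esub> (?N #> commutator G v y)"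
    by (simp add: FactGroup_def)
qed

lemma commutator_pow:
  fixes m k :: nat
  assumes u: "u \<in> lower_central_series G n" and y: "y \<in> carrier G"
  shows "lower_central_series G (Suc (Suc n)) #> commutator G (u [^] k) (y [^] m)
       = lower_central_series G (Suc (Suc n)) #> (commutator G u y [^] (k * m))"
proof -
  let ?N = "lower_central_series G (Suc (Suc n))" and ?S = "lower_central_series G n"
  interpret N: normal ?N G by (rule lower_central_series_normal)
  interpret Q: group "G Mod ?N" by (rule N.factorgroup_is_group)
  interpret S: group "G\<lparr>carrier := ?S\<rparr>"
    by (rule subgroup_imp_group[OF lower_central_series_subgroup])
  have ym: "y [^] m \<in> carrier G" using y by simp
  have uc: "u \<in> carrier G" using u by (rule lower_central_series_in_carrier)
  interpret L: group_hom "G\<lparr>carrier := ?S\<rparr>" "G Mod ?N" "\<lambda>u. ?N #> commutator G u (y [^] m)"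
    by unfold_locales (rule commutator_hom_left[OF ym])
  interpret R: group_hom G "G Mod ?N" "\<lambda>y. ?N #> commutator G u y"
    by unfold_locales (rule commutator_hom_right[OF u])
  interpret P: group_hom G "G Mod ?N" "\<lambda>y. ?N #> y"
    by unfold_locales (rule N.r_coset_hom_Mod)
  \<comment> \<open>The first entry gives up its exponent while the second is held at
    \<open>y [^] m\<close>; the homomorphism in the second entry then releases
    \<open>m\<close>.\<close>
  have "?N #> commutator G (u [^] k) (y [^] m) = (?N #> commutator G u (y [^] m)) [^]\<^bsub>G Mod ?N\<^esub> k"
    using L.hom_nat_pow[of u k] u by (simp flip: nat_pow_consistent)
  also have "\<dots> = ((?N #> commutator G u y) [^]\<^bsub>G Mod ?N\<^esub> m) [^]\<^bsub>G Mod ?N\<^esub> k"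
    using R.hom_nat_pow[of y m] y by simp
  also have "\<dots> = (?N #> commutator G u y) [^]\<^bsub>G Mod ?N\<^esub> (m * k)"
    by (rule Q.nat_pow_pow) (rule R.hom_closed[OF y])
  also have "\<dots> = ?N #> (commutator G u y [^] (k * m))"
    using P.hom_nat_pow[of "commutator G u y" "k * m"] uc y by (simp add: mult.commute)
  finally show ?thesis .
qed

end

lemma (in group_hom) subgroup_vimage:
  assumes "subgroup K H"
  shows "subgroup {x \<in> carrier G. h x \<in> K} G"
  using subgroup.m_closed[OF assms] subgroup.m_inv_closed[OF assms] subgroup.one_closed[OF assms]
  by unfold_locales auto

section \<open>Subgroups defined by the values of the commutator\<close>

context group
begin

text \<open>A subgroup containing \<open>N\<close> is a union of cosets of \<open>N\<close>. This
  lets a preimage under the bracket, taken in the quotient, be read off in \<open>G\<close>.\<close>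

lemma rcoset_image_mem_iff:
  assumes "N \<lhd> G" "subgroup W G" "N \<subseteq> W" "x \<in> carrier G"
  shows "N #> x \<in> (\<lambda>w. N #> w) ` W \<longleftrightarrow> x \<in> W"
proof
  assume "N #> x \<in> (\<lambda>w. N #> w) ` W"
  then obtain w where w: "w \<in> W" "N #> x = N #> w" by blast
  then have "x \<in> N #> w"
    using rcos_self[OF assms(4) normal_imp_subgroup[OF assms(1)]] by simp
  then obtain y where "y \<in> N" "x = y \<otimes> w" by (auto simp: r_coset_def)
  then show "x \<in> W" using w(1) assms(2,3) by (auto intro: subgroup.m_closed)
qed auto

text \<open>Since the bracket is a homomorphism in either argument modulo the next term but one, it
  vanishes modulo \<open>W\<close> on a subgroup.\<close>

lemma subgroup_commutator_right:
  assumes W: "subgroup W G" "lower_central_series G (Suc (Suc n)) \<subseteq> W"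
    and u: "u \<in> lower_central_series G n"
  shows "subgroup {y \<in> carrier G. commutator G u y \<in> W} G"
proof -
  let ?N = "lower_central_series G (Suc (Suc n))"
  interpret N: normal ?N G by (rule lower_central_series_normal)
  interpret P: group_hom G "G Mod ?N" "\<lambda>y. ?N #> y"
    by (intro group_hom.intro group_hom_axioms.intro N.r_coset_hom_Mod N.factorgroup_is_group is_group)
  interpret R: group_hom G "G Mod ?N" "\<lambda>y. ?N #> commutator G u y"
    by unfold_locales (rule commutator_hom_right[OF u])
  have "subgroup {y \<in> carrier G. ?N #> commutator G u y \<in> (\<lambda>w. ?N #> w) ` W} G"
    by (rule R.subgroup_vimage[OF P.subgroup_img_is_subgroup[OF W(1)]])
  also have "{y \<in> carrier G. ?N #> commutator G u y \<in> (\<lambda>w. ?N #> w) ` W}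
      = {y \<in> carrier G. commutator G u y \<in> W}"
    using lower_central_series_in_carrier[OF u]
    by (simp add: rcoset_image_mem_iff[OF N.normal_axioms W] cong: conj_cong)
  finally show ?thesis .
qed

lemma subgroup_commutator_left:
  assumes W: "subgroup W G" "lower_central_series G (Suc (Suc n)) \<subseteq> W"
    and y: "y \<in> carrier G"
  shows "subgroup {u \<in> lower_central_series G n. commutator G u y \<in> W} G"
proof -
  let ?N = "lower_central_series G (Suc (Suc n))" and ?S = "lower_central_series G n"
  interpret N: normal ?N G by (rule lower_central_series_normal)
  interpret P: group_hom G "G Mod ?N" "\<lambda>y. ?N #> y"
    by (intro group_hom.intro group_hom_axioms.intro N.r_coset_hom_Mod N.factorgroup_is_group is_group)
  interpret L: group_hom "G\<lparr>carrier := ?S\<rparr>" "G Mod ?N" "\<lambda>u. ?N #> commutator G u y"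
    by (intro group_hom.intro group_hom_axioms.intro commutator_hom_left[OF y]
        N.factorgroup_is_group subgroup_imp_group[OF lower_central_series_subgroup])
  have "subgroup {u \<in> ?S. ?N #> commutator G u y \<in> (\<lambda>w. ?N #> w) ` W} (G\<lparr>carrier := ?S\<rparr>)"
    using L.subgroup_vimage[OF P.subgroup_img_is_subgroup[OF W(1)]] by simp
  also have "{u \<in> ?S. ?N #> commutator G u y \<in> (\<lambda>w. ?N #> w) ` W}
      = {u \<in> ?S. commutator G u y \<in> W}"
    using y lower_central_series_in_carrier
    by (simp add: rcoset_image_mem_iff[OF N.normal_axioms W] cong: conj_cong)
  finally show ?thesis by (rule incl_subgroup[OF lower_central_series_subgroup])
qed

lemma lower_central_series_Suc_elim:
  assumes "x \<in> lower_central_series G (Suc n)"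
    and "subgroup W G"
    and "\<And>u y. \<lbrakk>u \<in> lower_central_series G n; y \<in> carrier G\<rbrakk> \<Longrightarrow> commutator G u y \<in> W"
  shows "x \<in> W"
proof -
  have "lower_central_series G (Suc n) \<subseteq> W"
    unfolding lower_central_series_Suc by (rule generate_subgroup_incl) (use assms in auto)
  then show ?thesis using assms(1) by blast
qed

end


section \<open>Nilpotency of subgroups and of direct products\<close>

section \<open>Subgroups and products\<close>

lemma (in group) commutator_consistent:
  assumes "subgroup S G" "x \<in> S" "y \<in> S"
  shows "commutator (G\<lparr>carrier := S\<rparr>) x y = commutator G x y"
  using assms by (simp add: commutator_def m_inv_consistent)

lemma (in group) lower_central_series_subgroup_subset:
  assumes S: "subgroup S G"
  shows "lower_central_series (G\<lparr>carrier := S\<rparr>) n \<subseteq> lower_central_series G n"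
proof (induction n)
  case 0
  then show ?case using subgroup.subset[OF S] by simp
next
  case (Suc n)
  interpret S: group "G\<lparr>carrier := S\<rparr>" by (rule subgroup_imp_group[OF S])
  show ?case
  proof
    fix x assume x: "x \<in> lower_central_series (G\<lparr>carrier := S\<rparr>) (Suc n)"
    \<comment> \<open>The elimination rule for the restricted group asks for a subgroup of
      \<open>S\<close>, whence the intersection.\<close>
    have "x \<in> lower_central_series G (Suc n) \<inter> S"
    proof (rule S.lower_central_series_Suc_elim[OF x])
      show "subgroup (lower_central_series G (Suc n) \<inter> S) (G\<lparr>carrier := S\<rparr>)"
        by (rule subgroup_incl[OF subgroups_Inter_pair[OF lower_central_series_subgroup S] S]) simp
      fix u y
      assume u: "u \<in> lower_central_series (G\<lparr>carrier := S\<rparr>) n"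
        and y: "y \<in> carrier (G\<lparr>carrier := S\<rparr>)"
      have uS: "u \<in> S" using S.lower_central_series_in_carrier[OF u] by simp
      have "commutator G u y \<in> lower_central_series G (Suc n)"
        using u y Suc subgroup.subset[OF S] by (auto intro: commutator_in_lower_central_series)
      then show "commutator (G\<lparr>carrier := S\<rparr>) u y \<in> lower_central_series G (Suc n) \<inter> S"
        using S.commutator_closed[of u y] uS y by (simp add: commutator_consistent[OF S])
    qed
    then show "x \<in> lower_central_series G (Suc n)" by simp
  qed
qed

lemma nilpotent_group_subgroup:
  assumes "nilpotent_group G" "subgroup S G"
  shows "nilpotent_group (G\<lparr>carrier := S\<rparr>)"
proof -
  interpret group G using assms(1) by (simp add: nilpotent_group_def)
  interpret S: group "G\<lparr>carrier := S\<rparr>" by (rule subgroup_imp_group[OF assms(2)])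
  obtain c where "lower_central_series G c = {\<one>\<^bsub>G\<^esub>}"
    using assms(1) by (auto simp: nilpotent_group_def)
  then have "lower_central_series (G\<lparr>carrier := S\<rparr>) c = {\<one>\<^bsub>G\<^esub>}"
    using lower_central_series_subgroup_subset[OF assms(2), of c]
      subgroup.one_closed[OF S.lower_central_series_subgroup, of c] by auto
  then show ?thesis using S.is_group by (auto simp: nilpotent_group_def)
qed

lemma lower_central_series_DirProd:
  assumes "group G" "group H"
  shows "lower_central_series (G \<times>\<times> H) n \<subseteq> lower_central_series G n \<times> lower_central_series H n"
proof (induction n)
  case 0
  then show ?case by simp
next
  case (Suc n)
  interpret G: group G by fact
  interpret H: group H by fact
  interpret P: group "G \<times>\<times> H" by (rule DirProd_group) fact+
  show ?case
  proof
    fix x assume x: "x \<in> lower_central_series (G \<times>\<times> H) (Suc n)"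
    show "x \<in> lower_central_series G (Suc n) \<times> lower_central_series H (Suc n)"
    proof (rule P.lower_central_series_Suc_elim[OF x])
      show "subgroup (lower_central_series G (Suc n) \<times> lower_central_series H (Suc n)) (G \<times>\<times> H)"
        by (intro DirProd_subgroups assms G.lower_central_series_subgroup H.lower_central_series_subgroup)
      fix u y assume u: "u \<in> lower_central_series (G \<times>\<times> H) n" and y: "y \<in> carrier (G \<times>\<times> H)"
      obtain a b c d where ab: "u = (a, b)" "y = (c, d)" by (metis surj_pair)
      have a: "a \<in> lower_central_series G n" "b \<in> lower_central_series H n"
        and c: "c \<in> carrier G" "d \<in> carrier H"
        using u y Suc ab by auto
      have "commutator (G \<times>\<times> H) u y = (commutator G a c, commutator H b d)"
        using c G.lower_central_series_in_carrier[OF a(1)] H.lower_central_series_in_carrier[OF a(2)]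
          assms by (simp add: ab commutator_def)
      then show "commutator (G \<times>\<times> H) u y
          \<in> lower_central_series G (Suc n) \<times> lower_central_series H (Suc n)"
        using G.commutator_in_lower_central_series[OF a(1) c(1)]
          H.commutator_in_lower_central_series[OF a(2) c(2)] by simp
    qed
  qed
qed

lemma nilpotent_group_DirProd:
  assumes "nilpotent_group G" "nilpotent_group H"
  shows "nilpotent_group (G \<times>\<times> H)"
proof -
  interpret G: group G using assms(1) by (simp add: nilpotent_group_def)
  interpret H: group H using assms(2) by (simp add: nilpotent_group_def)
  interpret P: group "G \<times>\<times> H" by (rule DirProd_group) (rule G.is_group H.is_group)+
  obtain c d where c: "lower_central_series G c = {\<one>\<^bsub>G\<^esub>}" and d: "lower_central_series H d = {\<one>\<^bsub>H\<^esub>}"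
    using assms by (auto simp: nilpotent_group_def)
  \<comment> \<open>At \<open>max c d\<close> both series are already trivial, since they
    descend.\<close>
  have "lower_central_series (G \<times>\<times> H) (max c d) \<subseteq> {\<one>\<^bsub>G\<^esub>} \<times> {\<one>\<^bsub>H\<^esub>}"
    using lower_central_series_DirProd[OF G.is_group H.is_group, of "max c d"]
      G.lower_central_series_antimono[of c "max c d"] H.lower_central_series_antimono[of d "max c d"]
      c d by (simp, blast)
  then have "lower_central_series (G \<times>\<times> H) (max c d) = {\<one>\<^bsub>G \<times>\<times> H\<^esub>}"
    using subgroup.one_closed[OF P.lower_central_series_subgroup, of "max c d"] by auto
  then show ?thesis using P.is_group by (auto simp: nilpotent_group_def)
qed


section \<open>Products of high powers as \<open>q\<close>-th powers modulo terms of the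
  series\<close>

section \<open>Roots\<close>

context group
begin

lemma coset_pow_mult:
  fixes q :: nat
  assumes "N \<lhd> G" "a \<in> carrier G" "b \<in> carrier G" "N #> (a \<otimes> b) = N #> (b \<otimes> a)"
  shows "N #> ((a \<otimes> b) [^] q) = N #> (a [^] q \<otimes> b [^] q)"
proof -
  interpret N: normal N G by (rule assms(1))
  interpret P: group_hom G "G Mod N" "\<lambda>y. N #> y"
    by (intro group_hom.intro group_hom_axioms.intro N.r_coset_hom_Mod N.factorgroup_is_group is_group)
  have "N #> ((a \<otimes> b) [^] q) = ((N #> a) \<otimes>\<^bsub>G Mod N\<^esub> (N #> b)) [^]\<^bsub>G Mod N\<^esub> q"
    using P.hom_nat_pow[of "a \<otimes> b" q] P.hom_mult[of a b] assms(2,3) by simp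
  also have "\<dots> = ((N #> a) [^]\<^bsub>G Mod N\<^esub> q) \<otimes>\<^bsub>G Mod N\<^esub> ((N #> b) [^]\<^bsub>G Mod N\<^esub> q)"
  proof (rule P.H.pow_mult_distrib)
    show "(N #> a) \<otimes>\<^bsub>G Mod N\<^esub> (N #> b) = (N #> b) \<otimes>\<^bsub>G Mod N\<^esub> (N #> a)"
      using P.hom_mult[of a b] P.hom_mult[of b a] assms(2-4) by simp
  qed (rule P.hom_closed assms)+
  also have "\<dots> = N #> (a [^] q \<otimes> b [^] q)"
    using P.hom_nat_pow[of a q] P.hom_nat_pow[of b q] P.hom_mult[of "a [^] q" "b [^] q"] assms(2,3)
    by simp
  finally show ?thesis .
qed

text \<open>Modulo term \<open>Suc n\<close> of \<open>G\<close>, the \<open>q\<close>-th powers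
  from term \<open>n\<close> form a subgroup, because term \<open>n\<close> is central there. For
  \<open>n = 0\<close> it contains the generators of \<open>S\<close>. For larger \<open>n\<close>,
  the term of \<open>S\<close> is generated by commutators with second entry in \<open>S\<close>,
  and bilinearity turns a commutator with \<open>g [^] q\<close> into the \<open>q\<close>-th power
  of the one with \<open>g\<close>.\<close>

lemma lower_central_series_generate_pow:
  fixes q :: nat
  defines "S \<equiv> generate G {g [^] q | g. g \<in> carrier G}"
  assumes "x \<in> lower_central_series (G\<lparr>carrier := S\<rparr>) n"
  shows "\<exists>b \<in> lower_central_series G n.
    lower_central_series G (Suc n) #> x = lower_central_series G (Suc n) #> (b [^] q)"
proof -
  let ?A = "lower_central_series G n" and ?B = "lower_central_series G (Suc n)"
  interpret A: normal ?A G by (rule lower_central_series_normal)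
  interpret B: normal ?B G by (rule lower_central_series_normal)
  interpret P: group_hom G "G Mod ?B" "\<lambda>y. ?B #> y"
    by (intro group_hom.intro group_hom_axioms.intro B.r_coset_hom_Mod B.factorgroup_is_group is_group)
  have Sc: "{g [^] q | g. g \<in> carrier G} \<subseteq> carrier G" by auto
  have S: "subgroup S G" unfolding S_def by (rule generate_is_subgroup[OF Sc])
  have pow_mult: "?B #> ((a \<otimes> b) [^] q) = ?B #> (a [^] q \<otimes> b [^] q)" if "a \<in> ?A" "b \<in> ?A" for a b
    using that A.subset
    by (intro coset_pow_mult B.normal_axioms lower_central_series_coset_commute) auto
  define R where "R = {y \<in> carrier G. \<exists>b\<in>?A. ?B #> y = ?B #> (b [^] q)}"
  have R: "subgroup R G"
  proof (rule subgroupI)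
    show "R \<subseteq> carrier G" by (auto simp: R_def)
    have "\<one> \<in> R" by (auto simp: R_def intro!: bexI[of _ \<one>])
    then show "R \<noteq> {}" by auto
  next
    fix y assume "y \<in> R"
    then obtain b where b: "y \<in> carrier G" "b \<in> ?A" "?B #> y = ?B #> (b [^] q)" by (auto simp: R_def)
    have bc: "b \<in> carrier G" using b(2) A.subset by auto
    have "?B #> inv y = ?B #> (inv b [^] q)"
      using b bc by (simp add: nat_pow_inv)
    then show "inv y \<in> R" using b bc by (auto simp: R_def intro!: bexI[of _ "inv b"])
  next
    fix y z assume "y \<in> R" "z \<in> R"
    then obtain b c where b: "y \<in> carrier G" "b \<in> ?A" "?B #> y = ?B #> (b [^] q)"
      and c: "z \<in> carrier G" "c \<in> ?A" "?B #> z = ?B #> (c [^] q)" by (auto simp: R_def)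
    have bc: "b \<in> carrier G" "c \<in> carrier G" using b(2) c(2) A.subset by auto
    have "?B #> (y \<otimes> z) = ?B #> (b [^] q \<otimes> c [^] q)"
      using b c bc by simp
    also have "\<dots> = ?B #> ((b \<otimes> c) [^] q)" by (rule pow_mult[OF b(2) c(2), symmetric])
    finally show "y \<otimes> z \<in> R" using b c by (auto simp: R_def intro!: bexI[of _ "b \<otimes> c"])
  qed
  have "x \<in> R"
  proof (cases n)
    case 0
    have "S \<subseteq> R"
      unfolding S_def by (rule generate_subgroup_incl[OF _ R]) (auto simp: R_def 0)
    then show ?thesis using assms(2) 0 by auto
  next
    case (Suc k)
    interpret S: group "G\<lparr>carrier := S\<rparr>" by (rule subgroup_imp_group[OF S])
    \<comment> \<open>The bracket argument needs \<open>R\<close> to contain the modulus, whose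
      elements are congruent to \<open>\<one> [^] q\<close>.\<close>
    have BR: "?B \<subseteq> R"
      using B.subset B.rcos_const by (auto simp: R_def intro!: bexI[of _ \<one>])
    have "x \<in> R \<inter> S"
    proof (rule S.lower_central_series_Suc_elim[OF assms(2)[unfolded Suc]])
      show "subgroup (R \<inter> S) (G\<lparr>carrier := S\<rparr>)"
        by (rule subgroup_incl[OF subgroups_Inter_pair[OF R S] S]) simp
      fix u y
      assume u: "u \<in> lower_central_series (G\<lparr>carrier := S\<rparr>) k" and y: "y \<in> carrier (G\<lparr>carrier := S\<rparr>)"
      have uS: "u \<in> S" using S.lower_central_series_in_carrier[OF u] by simp
      have uG: "u \<in> lower_central_series G k"
        using u lower_central_series_subgroup_subset[OF S] by auto
      \<comment> \<open>With \<open>u\<close> fixed, the admissible second entries form a subgroup,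
        so only the \<open>q\<close>-th powers generating \<open>S\<close> need checking.\<close>
      have "S \<subseteq> {y \<in> carrier G. commutator G u y \<in> R}"
        unfolding S_def
      proof (rule generate_subgroup_incl)
        show "subgroup {y \<in> carrier G. commutator G u y \<in> R} G"
          by (rule subgroup_commutator_right[OF R _ uG]) (use BR Suc in simp)
        have "commutator G u (g [^] q) \<in> R" if g: "g \<in> carrier G" for g
          using commutator_pow[OF uG g, of 1 q] commutator_in_lower_central_series[OF uG g]
            lower_central_series_in_carrier[OF uG] g
          by (auto simp: R_def Suc)
        then show "{g [^] q |g. g \<in> carrier G} \<subseteq> {y \<in> carrier G. commutator G u y \<in> R}" by auto
      qed
      then show "commutator (G\<lparr>carrier := S\<rparr>) u y \<in> R \<inter> S"
        using S.commutator_closed[of u y] uS y by (auto simp: commutator_consistent[OF S])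
    qed
    then show ?thesis by simp
  qed
  then show ?thesis by (auto simp: R_def)
qed

end

text \<open>The induction hypothesis is applied to the subgroup generated by the \<open>q\<close>-th powers: its
  lower central series consists of \<open>q\<close>-th powers modulo the next term of that of \<open>G\<close>.\<close>

lemma generate_pow_root:
  fixes q :: nat and G :: "('a, 'm) monoid_scheme"
  assumes "group G" "x \<in> generate G {g [^]\<^bsub>G\<^esub> (q ^ n) | g. g \<in> carrier G}"
  shows "\<exists>g \<in> carrier G. lower_central_series G n #>\<^bsub>G\<^esub> x = lower_central_series G n #>\<^bsub>G\<^esub> (g [^]\<^bsub>G\<^esub> q)"
  using assms
proof (induction n arbitrary: G x)
  case 0
  then interpret group G by simp
  have "generate G {g [^]\<^bsub>G\<^esub> (q ^ 0) | g. g \<in> carrier G} \<subseteq> carrier G"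
    by (rule generate_incl) auto
  then have "x \<in> carrier G" using 0 by auto
  \<comment> \<open>Term \<open>0\<close> is all of \<open>G\<close>, so there is a single coset and
    \<open>\<one>\<close> serves as root.\<close>
  then show ?case
    using coset_join2[OF _ subgroup_self] by (auto intro!: bexI[of _ "\<one>\<^bsub>G\<^esub>"])
next
  case (Suc n)
  then interpret group G by simp
  define S where "S = generate G {g [^]\<^bsub>G\<^esub> q | g. g \<in> carrier G}"
  have S: "subgroup S G" unfolding S_def by (rule generate_is_subgroup) auto
  interpret S: group "G\<lparr>carrier := S\<rparr>" by (rule subgroup_imp_group[OF S])
  let ?A = "lower_central_series G n" and ?B = "lower_central_series G (Suc n)"
  interpret B: normal ?B G by (rule lower_central_series_normal)
  have sub: "{g [^]\<^bsub>G\<^esub> (q ^ n) | g. g \<in> S} \<subseteq> S"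
    using S.nat_pow_closed by (auto simp flip: nat_pow_consistent)
  \<comment> \<open>One factor \<open>q\<close> is spent on entering \<open>S\<close>, leaving the
    exponent \<open>q ^ n\<close> that the induction hypothesis for \<open>S\<close>
    expects.\<close>
  have "g [^]\<^bsub>G\<^esub> (q ^ Suc n) \<in> {g [^]\<^bsub>G\<^esub> (q ^ n) | g. g \<in> S}" if g: "g \<in> carrier G" for g
  proof -
    have "g [^]\<^bsub>G\<^esub> q \<in> S" unfolding S_def by (rule generate.incl) (use g in auto)
    moreover have "g [^]\<^bsub>G\<^esub> (q ^ Suc n) = (g [^]\<^bsub>G\<^esub> q) [^]\<^bsub>G\<^esub> (q ^ n)" using g by (simp add: nat_pow_pow)
    ultimately show ?thesis by blast
  qed
  then have "generate G {g [^]\<^bsub>G\<^esub> (q ^ Suc n) | g. g \<in> carrier G} \<subseteq> generate G {g [^]\<^bsub>G\<^esub> (q ^ n) | g. g \<in> S}"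
    by (intro mono_generate) auto
  then have xgen: "x \<in> generate (G\<lparr>carrier := S\<rparr>) {g [^]\<^bsub>G\<^esub> (q ^ n) | g. g \<in> S}"
    using Suc.prems generate_consistent[OF sub S] by auto
  then have "x \<in> generate (G\<lparr>carrier := S\<rparr>)
      {g [^]\<^bsub>G\<lparr>carrier := S\<rparr>\<^esub> (q ^ n) | g. g \<in> carrier (G\<lparr>carrier := S\<rparr>)}"
    by (simp flip: nat_pow_consistent)
  from Suc.IH[OF S.is_group this] obtain g where g: "g \<in> S"
    "lower_central_series (G\<lparr>carrier := S\<rparr>) n #>\<^bsub>G\<^esub> x = lower_central_series (G\<lparr>carrier := S\<rparr>) n #>\<^bsub>G\<^esub> (g [^]\<^bsub>G\<^esub> q)"
    by (auto simp: r_coset_def simp flip: nat_pow_consistent)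
  have gc: "g \<in> carrier G" using g(1) subgroup.subset[OF S] by auto
  have xS: "x \<in> S" using xgen S.generate_in_carrier[of "{g [^]\<^bsub>G\<^esub> (q ^ n) | g. g \<in> S}"] sub by simp
  then have "x \<in> lower_central_series (G\<lparr>carrier := S\<rparr>) n #>\<^bsub>G\<^esub> x"
    using S.rcos_self[OF _ S.lower_central_series_subgroup, of x n] by (simp add: r_coset_def)
  \<comment> \<open>\<open>x\<close> is \<open>g [^] q\<close> up to an error \<open>a\<close> in
    term \<open>n\<close> of the series of \<open>S\<close>. The error is itself some
    \<open>b [^] q\<close> modulo term \<open>Suc n\<close> of \<open>G\<close>, where
    \<open>b\<close> is central, so the two powers merge into one.\<close>
  then obtain a where a: "a \<in> lower_central_series (G\<lparr>carrier := S\<rparr>) n" "x = a \<otimes>\<^bsub>G\<^esub> g [^]\<^bsub>G\<^esub> q"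
    using g(2) by (auto simp: r_coset_def)
  obtain b where b: "b \<in> ?A" "?B #>\<^bsub>G\<^esub> a = ?B #>\<^bsub>G\<^esub> (b [^]\<^bsub>G\<^esub> q)"
    using lower_central_series_generate_pow a(1) unfolding S_def by blast
  have ac: "a \<in> carrier G"
    using a(1) lower_central_series_subgroup_subset[OF S, of n] lower_central_series_in_carrier by blast
  have bc: "b \<in> carrier G" using b(1) by (rule lower_central_series_in_carrier)
  have "?B #>\<^bsub>G\<^esub> x = ?B #>\<^bsub>G\<^esub> (b [^]\<^bsub>G\<^esub> q \<otimes>\<^bsub>G\<^esub> g [^]\<^bsub>G\<^esub> q)"
    using a(2) b(2) ac bc gc B.rcos_sum[of a "g [^]\<^bsub>G\<^esub> q"]
      B.rcos_sum[of "b [^]\<^bsub>G\<^esub> q" "g [^]\<^bsub>G\<^esub> q"] by (metis nat_pow_closed)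
  also have "\<dots> = ?B #>\<^bsub>G\<^esub> ((b \<otimes>\<^bsub>G\<^esub> g) [^]\<^bsub>G\<^esub> q)"
    by (rule coset_pow_mult[OF B.normal_axioms bc gc lower_central_series_coset_commute[OF b(1) gc],
          symmetric])
  finally show ?case using bc gc by (intro bexI[of _ "b \<otimes>\<^bsub>G\<^esub> g"]) simp_all
qed


section \<open>Finite index from powers of generators\<close>

section \<open>Subgroups of finite index\<close>

context group
begin

lemma normalizing_pow:
  fixes k :: nat
  assumes D: "subgroup D G" and c: "c \<in> carrier G" and d: "d \<in> D"
    and norm: "\<And>d. d \<in> D \<Longrightarrow> c \<otimes> d \<otimes> inv c \<in> D"
  shows "c [^] k \<otimes> d \<otimes> inv (c [^] k) \<in> D"
proof (induction k)
  case 0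
  then show ?case using d subgroup.mem_carrier[OF D] by simp
next
  case (Suc k)
  have "c [^] Suc k \<otimes> d \<otimes> inv (c [^] Suc k) = c \<otimes> (c [^] k \<otimes> d \<otimes> inv (c [^] k)) \<otimes> inv c"
    using c subgroup.mem_carrier[OF D d] by (simp only: nat_pow_Suc2[OF c]) (simp add: group_simps)
  then show ?case using norm[OF Suc] by (simp only:)
qed

text \<open>\<open>E\<close> consists of the products \<open>d \<otimes> c [^] k\<close>. Natural
  exponents suffice because \<open>c [^] n\<close> lies in \<open>D\<close>; for the same reason the
  powers of \<open>c\<close> below \<open>n\<close> serve as \<open>T\<close>.\<close>

lemma finite_index_extend:
  fixes n :: nat
  assumes D: "subgroup D G" and c: "c \<in> carrier G"
    and norm: "\<And>d. d \<in> D \<Longrightarrow> c \<otimes> d \<otimes> inv c \<in> D"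
    and n: "n \<ge> 1" "c [^] n \<in> D"
  shows "\<exists>T E. finite T \<and> T \<subseteq> carrier G \<and> subgroup E G \<and> insert c D \<subseteq> E \<and> E \<subseteq> D <#> T"
proof -
  define E where "E = {d \<otimes> c [^] k | d (k::nat). d \<in> D}"
  note Dc = subgroup.mem_carrier[OF D]
  have shift: "c [^] k \<otimes> d \<in> E" if "d \<in> D" for d and k :: nat
  proof -
    have "c [^] k \<otimes> d = (c [^] k \<otimes> d \<otimes> inv (c [^] k)) \<otimes> c [^] k"
      using c Dc[OF that] by (simp add: group_simps)
    then show ?thesis using normalizing_pow[OF D c that norm] unfolding E_def by blast
  qed
  have left: "d \<otimes> e \<in> E" if d: "d \<in> D" and e: "e \<in> E" for d e
  proof -
    obtain d' and k :: nat where "d' \<in> D" "e = d' \<otimes> c [^] k" using e by (auto simp: E_def)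
    then have "d \<otimes> e = (d \<otimes> d') \<otimes> c [^] k" "d \<otimes> d' \<in> D"
      using c Dc d by (simp_all add: m_assoc subgroup.m_closed[OF D])
    then show ?thesis unfolding E_def by blast
  qed
  have right: "e \<otimes> c [^] k \<in> E" if e: "e \<in> E" for e and k :: nat
  proof -
    obtain d and l :: nat where "d \<in> D" "e = d \<otimes> c [^] l" using e by (auto simp: E_def)
    then have "e \<otimes> c [^] k = d \<otimes> c [^] (l + k)" using c Dc by (simp add: m_assoc nat_pow_mult)
    then show ?thesis using \<open>d \<in> D\<close> unfolding E_def by blast
  qed
  have "subgroup E G"
  proof (rule subgroupI)
    show "E \<subseteq> carrier G" using c Dc by (auto simp: E_def)
    show "E \<noteq> {}" using subgroup.one_closed[OF D] by (auto simp: E_def)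
  next
    fix e assume "e \<in> E"
    then obtain d and k :: nat where d: "d \<in> D" "e = d \<otimes> c [^] k" by (auto simp: E_def)
    have "c [^] (n * k) \<in> D"
      using subgroup_int_pow_closed[OF D n(2), of "int k"] c by (simp add: int_pow_int nat_pow_pow)
    \<comment> \<open>\<open>inv (c [^] k)\<close> becomes an element of \<open>D\<close> times the
      power \<open>c [^] ((n - 1) * k)\<close>, avoiding negative exponents.\<close>
    moreover have "inv e = inv (c [^] (n * k)) \<otimes> (c [^] ((n - 1) * k) \<otimes> inv d)"
    proof -
      have "c [^] (n * k) = c [^] ((n - 1) * k) \<otimes> c [^] k"
        using n(1) c by (simp add: nat_pow_mult algebra_simps)
      then show ?thesis using d c Dc by (simp add: group_simps)
    qed
    ultimately show "inv e \<in> E"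
      using left shift d(1) subgroup.m_inv_closed[OF D] by simp
  next
    fix e f assume "e \<in> E" "f \<in> E"
    then obtain d d' and k l :: nat where d: "d \<in> D" "e = d \<otimes> c [^] k" "d' \<in> D" "f = d' \<otimes> c [^] l"
      by (auto simp: E_def)
    then have "e \<otimes> f = (d \<otimes> (c [^] k \<otimes> d')) \<otimes> c [^] l"
      using c Dc by (simp add: m_assoc)
    then show "e \<otimes> f \<in> E" using right[OF left[OF d(1) shift[OF d(3)]]] by simp
  qed
  moreover have "d \<in> E" if "d \<in> D" for d
  proof -
    have "d = d \<otimes> c [^] (0::nat)" using Dc[OF that] by simp
    then show ?thesis using that unfolding E_def by blast
  qed
  moreover have "c \<in> E"
    using shift[OF subgroup.one_closed[OF D], of 1] c by simp
  moreover have "E \<subseteq> D <#> {c [^] k | k. k < n}"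
  proof
    fix e assume "e \<in> E"
    then obtain d and k :: nat where d: "d \<in> D" "e = d \<otimes> c [^] k" by (auto simp: E_def)
    have "c [^] k = c [^] (n * (k div n)) \<otimes> c [^] (k mod n)" using c by (simp add: nat_pow_mult)
    moreover have "c [^] (n * (k div n)) \<in> D"
      using subgroup_int_pow_closed[OF D n(2), of "int (k div n)"] c
      by (simp add: int_pow_int nat_pow_pow)
    ultimately have "e = (d \<otimes> c [^] (n * (k div n))) \<otimes> c [^] (k mod n)"
      "d \<otimes> c [^] (n * (k div n)) \<in> D"
      using d c Dc subgroup.m_closed[OF D] by (simp_all add: m_assoc)
    moreover have "c [^] (k mod n) \<in> {c [^] k | k. k < n}" using n(1) by auto
    ultimately show "e \<in> D <#> {c [^] k | k. k < n}"
      unfolding set_mult_def by blast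
  qed
  ultimately show ?thesis
    using c by (intro exI[of _ "{c [^] k | k. k < n}"] exI[of _ E]) auto
qed

text \<open>Elements are adjoined one at a time. Each \<open>x\<close> normalises the subgroup
  reached so far, because conjugating \<open>d\<close> by \<open>x\<close> multiplies it by a
  commutator in term \<open>Suc n\<close>, which \<open>D\<close> contains.\<close>

lemma finite_index_extend_set:
  assumes "finite X" "X \<subseteq> lower_central_series G n"
    and D: "subgroup D G" "lower_central_series G (Suc n) \<subseteq> D"
    and "\<And>x. x \<in> X \<Longrightarrow> \<exists>k::nat. k \<ge> 1 \<and> x [^] k \<in> D"
  shows "\<exists>T E. finite T \<and> T \<subseteq> carrier G \<and> subgroup E G \<and> X \<union> D \<subseteq> E \<and> E \<subseteq> D <#> T"
  using assms(1,2,5)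
proof (induction X)
  case empty
  have "D \<subseteq> D <#> {\<one>}"
    using subgroup.subset[OF D(1)] by (simp flip: r_coset_eq_set_mult)
  then show ?case using D(1) by - (rule exI[of _ "{\<one>}"], rule exI[of _ D], auto)
next
  case (insert x X)
  have "X \<subseteq> lower_central_series G n" using insert.prems(1) by simp
  from insert.IH[OF this insert.prems(2)[OF insertI2]]
  obtain T E where E: "finite T" "T \<subseteq> carrier G" "subgroup E G" "X \<union> D \<subseteq> E" "E \<subseteq> D <#> T"
    by blast
  obtain k :: nat where k: "k \<ge> 1" "x [^] k \<in> D" using insert.prems(2)[of x] by blast
  have x: "x \<in> lower_central_series G n" using insert.prems(1) by simp
  then have xc: "x \<in> carrier G" by (rule lower_central_series_in_carrier)
  have "x \<otimes> d \<otimes> inv x \<in> E" if d: "d \<in> E" for d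
  proof -
    have dc: "d \<in> carrier G" using subgroup.mem_carrier[OF E(3) d] .
    have "x \<otimes> d \<otimes> inv x = commutator G x d \<otimes> d"
      using xc dc by (simp add: commutator_def group_simps)
    moreover have "commutator G x d \<in> E"
      using commutator_in_lower_central_series[OF x dc] D(2) E(4) by auto
    ultimately show ?thesis using d subgroup.m_closed[OF E(3)] by simp
  qed
  moreover have "x [^] k \<in> E" using k(2) E(4) by blast
  ultimately obtain T' E' where E': "finite T'" "T' \<subseteq> carrier G" "subgroup E' G" "insert x E \<subseteq> E'" "E' \<subseteq> E <#> T'"
    using finite_index_extend[OF E(3) xc _ k(1)] by blast
  have "E' \<subseteq> (D <#> T) <#> T'"
    using E'(5) mono_set_mult[OF E(5) order_refl] by (rule order_trans)
  also have "\<dots> = D <#> (T <#> T')"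
    using set_mult_assoc[OF subgroup.subset[OF D(1)] E(2) E'(2)] .
  finally have "E' \<subseteq> D <#> (T <#> T')" .
  moreover have "finite (T <#> T')" using E(1) E'(1) by (auto simp: set_mult_def)
  moreover have "T <#> T' \<subseteq> carrier G" using E(2) E'(2) by (rule set_mult_closed)
  ultimately show ?case using E'(3,4) E(4)
    by - (rule exI[of _ "T <#> T'"], rule exI[of _ E'], blast)
qed

text \<open>From one term to the next, \<open>Y\<close> is replaced by its commutators with
  \<open>X\<close>, which generate by bilinearity. If \<open>y [^] k = v \<otimes> h\<close> and
  \<open>x [^] m\<close> is in \<open>H\<close>, then the \<open>k * m\<close>-th power of the
  commutator of \<open>y\<close> and \<open>x\<close> is, modulo the term after, the commutator of
  \<open>h\<close> and \<open>x [^] m\<close>, an element of \<open>H\<close>: the factor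
  \<open>v\<close> contributes nothing.\<close>

lemma lower_central_series_finite_generators:
  assumes X: "finite X" "X \<subseteq> carrier G" "generate G X = carrier G"
    and H: "subgroup H G"
    and pow: "\<forall>x\<in>X. \<exists>k::nat. k \<ge> 1 \<and> x [^] k \<in> H"
  shows "\<exists>Y. finite Y \<and> Y \<subseteq> lower_central_series G n \<and>
    lower_central_series G n \<subseteq> generate G (Y \<union> lower_central_series G (Suc n)) \<and>
    (\<forall>y\<in>Y. \<exists>k::nat. k \<ge> 1 \<and> (\<exists>v\<in>lower_central_series G (Suc n). \<exists>h\<in>H. y [^] k = v \<otimes> h))"
proof (induction n)
  case 0
  have "carrier G \<subseteq> generate G (X \<union> lower_central_series G (Suc 0))"
    using X(3) mono_generate[of X] by blast
  moreover have "\<exists>k::nat. k \<ge> 1 \<and> (\<exists>v\<in>lower_central_series G (Suc 0). \<exists>h\<in>H. x [^] k = v \<otimes> h)"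
    if x: "x \<in> X" for x
  proof -
    obtain k :: nat where k: "k \<ge> 1" "x [^] k \<in> H" using bspec[OF pow x] by blast
    then have "x [^] k = \<one> \<otimes> x [^] k" using x X(2) by auto
    then show ?thesis
      using k subgroup.one_closed[OF lower_central_series_subgroup, of "Suc 0"] by blast
  qed
  ultimately show ?case using X(1,2) by (intro exI[of _ X]) simp
next
  case (Suc n)
  let ?A = "lower_central_series G n" and ?B = "lower_central_series G (Suc n)"
    and ?C = "lower_central_series G (Suc (Suc n))"
  note lc = lower_central_series_in_carrier
  interpret C: normal ?C G by (rule lower_central_series_normal)
  from Suc obtain Y where Y: "finite Y" "Y \<subseteq> ?A" "?A \<subseteq> generate G (Y \<union> ?B)"
    and Yp: "\<forall>y\<in>Y. \<exists>k::nat. k \<ge> 1 \<and> (\<exists>v\<in>?B. \<exists>h\<in>H. y [^] k = v \<otimes> h)"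
    by (elim exE conjE)
  define Z where "Z = (\<lambda>(y, x). commutator G y x) ` (Y \<times> X)"
  have ZB: "Z \<subseteq> ?B"
    using Y(2) X(2) by (auto simp: Z_def intro!: commutator_in_lower_central_series)
  define W where "W = generate G (Z \<union> ?C)"
  have W: "subgroup W G"
    unfolding W_def using ZB lc[of _ "Suc n"] C.subset by (intro generate_is_subgroup) blast
  have CW: "?C \<subseteq> W" and ZW: "Z \<subseteq> W" unfolding W_def by (auto intro: generate.incl)
  \<comment> \<open>Second entries are first extended from \<open>X\<close> to all of
    \<open>G\<close>; first entries are then extended from \<open>Y\<close> to the whole
    term.\<close>
  have YW: "commutator G y g \<in> W" if y: "y \<in> Y" and g: "g \<in> carrier G" for y g
  proof -
    have "generate G X \<subseteq> {g \<in> carrier G. commutator G y g \<in> W}"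
      by (rule generate_subgroup_incl[OF _ subgroup_commutator_right[OF W CW]])
        (use X(2) Y(2) ZW y in \<open>auto simp: Z_def\<close>)
    then show ?thesis using g X(3) by auto
  qed
  have AW: "commutator G u g \<in> W" if u: "u \<in> ?A" and g: "g \<in> carrier G" for u g
  proof -
    have "generate G (Y \<union> ?B) \<subseteq> {u \<in> ?A. commutator G u g \<in> W}"
      by (rule generate_subgroup_incl[OF _ subgroup_commutator_left[OF W CW g]])
        (use Y(2) YW g CW lower_central_series_Suc_subset[of n]
          commutator_in_lower_central_series[OF _ g, of _ "Suc n"] in auto)
    then show ?thesis using u Y(3) by auto
  qed
  have "?B \<subseteq> W"
    using lower_central_series_Suc_elim[OF _ W AW] by blast
  moreover have "\<exists>k::nat. k \<ge> 1 \<and> (\<exists>v\<in>?C. \<exists>h\<in>H. z [^] k = v \<otimes> h)" if z: "z \<in> Z" for z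
  proof -
    obtain y x where yx: "y \<in> Y" "x \<in> X" "z = commutator G y x" using z by (auto simp: Z_def)
    have y: "y \<in> ?A" "y \<in> carrier G" using yx(1) Y(2) lc by auto
    have x: "x \<in> carrier G" using yx(2) X(2) by auto
    obtain k :: nat and v h where k: "k \<ge> 1" "v \<in> ?B" "h \<in> H" "y [^] k = v \<otimes> h"
      using bspec[OF Yp yx(1)] by blast
    obtain m :: nat where m: "m \<ge> 1" "x [^] m \<in> H" using bspec[OF pow yx(2)] by blast
    define w where "w = x [^] m"
    have c: "v \<in> carrier G" "h \<in> carrier G" "w \<in> carrier G" "w \<in> H"
      using lc[OF k(2)] subgroup.mem_carrier[OF H k(3)] x m(2) by (auto simp: w_def)
    \<comment> \<open>Left linearity needs both factors of \<open>v \<otimes> h\<close> in term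
      \<open>n\<close>; for \<open>h\<close> this follows by solving for it.\<close>
    have hA: "h \<in> ?A"
    proof -
      have "h = inv v \<otimes> y [^] k" using c k(4) by (simp add: group_simps)
      moreover have "inv v \<in> ?A"
        using subgroup.m_inv_closed[OF lower_central_series_subgroup k(2)]
          lower_central_series_Suc_subset by auto
      moreover have "y [^] k \<in> ?A"
        using subgroup_int_pow_closed[OF lower_central_series_subgroup y(1), of "int k"]
        by (simp add: int_pow_int)
      ultimately show ?thesis using subgroup.m_closed[OF lower_central_series_subgroup] by simp
    qed
    have vA: "v \<in> ?A" using k(2) lower_central_series_Suc_subset by auto
    have "?C #> (z [^] (k * m)) = ?C #> commutator G (v \<otimes> h) w"
      using commutator_pow[OF y(1) x, of k m] k(4) yx(3) by (simp add: w_def)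
    also have "\<dots> = (?C #> commutator G v w) <#> (?C #> commutator G h w)"
      using hom_mult[OF commutator_hom_left[OF c(3), of n], of v h] vA hA
      by (simp add: FactGroup_def)
    also have "?C #> commutator G v w = ?C"
      using commutator_in_lower_central_series[OF k(2) c(3)] by (rule C.rcos_const[OF is_group])
    also have "?C <#> (?C #> commutator G h w) = ?C #> commutator G h w"
      using c C.subset by (intro C.rcosets_mult_eq rcosetsI) auto
    finally have "z [^] (k * m) \<in> ?C #> commutator G h w"
      using rcos_self[OF _ lower_central_series_subgroup, of "z [^] (k * m)" "Suc (Suc n)"] yx y x by simp
    moreover have "commutator G h w \<in> H"
      using k(3) c(4) by (simp add: commutator_def subgroup.m_closed[OF H] subgroup.m_inv_closed[OF H])
    moreover have "k * m \<ge> 1" using k(1) m(1) by simp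
    ultimately show ?thesis unfolding r_coset_def by blast
  qed
  moreover have "finite Z" using Y(1) X(1) by (simp add: Z_def)
  ultimately show ?case using ZB by (intro exI[of _ Z] conjI ballI) (simp_all only: W_def)
qed

text \<open>Going down the lower central series from its trivial term, each term is absorbed by adjoining
  finitely many elements that normalise what has been reached so far.\<close>

lemma nilpotent_finite_index:
  assumes "nilpotent_group G"
    and X: "finite X" "X \<subseteq> carrier G" "generate G X = carrier G"
    and H: "subgroup H G"
    and pow: "\<forall>x\<in>X. \<exists>k::nat. k \<ge> 1 \<and> x [^] k \<in> H"
  shows "\<exists>T. finite T \<and> T \<subseteq> carrier G \<and> carrier G = H <#> T"
proof -
  obtain c where c: "lower_central_series G c = {\<one>}"
    using assms(1) by (auto simp: nilpotent_group_def)
  have "\<exists>T D. finite T \<and> T \<subseteq> carrier G \<and> subgroup D G \<and> H \<union> lower_central_series G n \<subseteq> D \<and> D \<subseteq> H <#> T"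
    if "n \<le> c" for n
    using that
  \<comment> \<open>Descending induction: at \<open>c\<close> the subgroup \<open>D\<close> is
    \<open>H\<close>, at \<open>0\<close> it contains all of \<open>G\<close>.\<close>
  proof (induction n rule: inc_induct)
    case base
    have "H \<subseteq> H <#> {\<one>}"
      using subgroup.subset[OF H] by (simp flip: r_coset_eq_set_mult)
    then show ?case
      using H c subgroup.one_closed[OF H] by - (rule exI[of _ "{\<one>}"], rule exI[of _ H], auto)
  next
    case (step n)
    then obtain T D where D: "finite T" "T \<subseteq> carrier G" "subgroup D G"
      "H \<union> lower_central_series G (Suc n) \<subseteq> D" "D \<subseteq> H <#> T" by blast
    obtain Y where Y: "finite Y" "Y \<subseteq> lower_central_series G n"
      "lower_central_series G n \<subseteq> generate G (Y \<union> lower_central_series G (Suc n))"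
      and Yp: "\<forall>y\<in>Y. \<exists>k::nat. k \<ge> 1 \<and>
        (\<exists>v\<in>lower_central_series G (Suc n). \<exists>h\<in>H. y [^] k = v \<otimes> h)"
      using lower_central_series_finite_generators[OF X H pow, of n] by (elim exE conjE)
    \<comment> \<open>The factor \<open>v\<close> lies in \<open>D\<close> by the previous stage,
      and \<open>h\<close> because \<open>D\<close> contains \<open>H\<close>.\<close>
    have "\<exists>k::nat. k \<ge> 1 \<and> y [^] k \<in> D" if "y \<in> Y" for y
      using bspec[OF Yp that] D(4) subgroup.m_closed[OF D(3)] by (metis Un_iff subsetD)
    with finite_index_extend_set[OF Y(1,2) D(3)] D(4)
    obtain T' E where E: "finite T'" "T' \<subseteq> carrier G" "subgroup E G" "Y \<union> D \<subseteq> E" "E \<subseteq> D <#> T'"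
      by blast
    have "E \<subseteq> (H <#> T) <#> T'"
      using E(5) mono_set_mult[OF D(5) order_refl] by (rule order_trans)
    also have "\<dots> = H <#> (T <#> T')"
      using set_mult_assoc[OF subgroup.subset[OF H] D(2) E(2)] .
    finally have "E \<subseteq> H <#> (T <#> T')" .
    moreover have "finite (T <#> T')" using D(1) E(1) by (auto simp: set_mult_def)
    moreover have "T <#> T' \<subseteq> carrier G" using D(2) E(2) by (rule set_mult_closed)
    moreover have "generate G (Y \<union> lower_central_series G (Suc n)) \<subseteq> E"
      by (rule generate_subgroup_incl[OF _ E(3)]) (use E(4) D(4) in auto)
    ultimately show ?case
      using E(3,4) D(4) Y(3) by - (rule exI[of _ "T <#> T'"], rule exI[of _ E], auto)
  qed
  from this[of 0] obtain T where T: "finite T" "T \<subseteq> carrier G" "carrier G \<subseteq> H <#> T"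
    by auto
  then show ?thesis using set_mult_closed[OF subgroup.subset[OF H] T(2)] by blast
qed

lemma finite_cover_imp_finite_rcosets:
  assumes "subgroup H G" "finite T" "T \<subseteq> carrier G" "carrier G = H <#> T"
  shows "finite (rcosets H)"
proof -
  have "rcosets H \<subseteq> (\<lambda>t. H #> t) ` T"
  proof
    fix C assume "C \<in> rcosets H"
    then obtain a where a: "a \<in> carrier G" "C = H #> a" by (auto simp: RCOSETS_def)
    then obtain h t where t: "h \<in> H" "t \<in> T" "a = h \<otimes> t" using assms(4) by (auto simp: set_mult_def)
    have "a \<in> H #> t" using t by (auto simp: r_coset_def)
    then have "C = H #> t"
      using a t(2) assms(1,3) repr_independence[of a H t] by auto
    then show "C \<in> (\<lambda>t. H #> t) ` T" using t(2) by blast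
  qed
  then show ?thesis using assms(2) finite_surj by blast
qed

text \<open>Pigeonhole: two powers of \<open>x\<close> share a coset, and the difference of their
  exponents is the required one.\<close>

lemma finite_index_pow_mem:
  assumes "finite_index_subgroup H G" "x \<in> carrier G"
  shows "\<exists>k::nat. k \<ge> 1 \<and> x [^] k \<in> H"
proof -
  have H: "subgroup H G" and fin: "finite (rcosets H)"
    using assms(1) by (auto simp: finite_index_subgroup_def)
  have "range (\<lambda>k::nat. H #> (x [^] k)) \<subseteq> rcosets H"
    using assms(2) by (auto simp: RCOSETS_def)
  then have "\<not> inj (\<lambda>k::nat. H #> (x [^] k))"
    using fin by (meson finite_imageD finite_subset infinite_UNIV_nat)
  then obtain a b :: nat where ab: "a < b" "H #> (x [^] a) = H #> (x [^] b)"
    by (metis (no_types, lifting) injI linorder_neqE_nat)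
  have "x [^] b \<in> H #> (x [^] a)"
    using ab(2) rcos_self[OF _ H] assms(2) by simp
  then obtain h where h: "h \<in> H" "x [^] b = h \<otimes> x [^] a" by (auto simp: r_coset_def)
  have "x [^] (b - a) \<otimes> x [^] a = x [^] b" using ab(1) assms(2) by (simp add: nat_pow_mult)
  then have "x [^] (b - a) = h"
    using h subgroup.mem_carrier[OF H h(1)] assms(2) by simp
  then show ?thesis using h(1) ab(1) by (intro exI[of _ "b - a"]) auto
qed

end

text \<open>It serves twice: for the subgroup of \<open>G\<close> generated by powers, and for the
  graph of \<open>\<iota> \<circ> f\<close> inside the image of the free group. In the latter case
  \<open>finite_index_pow_mem\<close> carries the power condition from generators to all
  elements.\<close>

lemma nilpotent_finite_index_subgroup:
  assumes "nilpotent_group G" "finite X" "X \<subseteq> carrier G" "generate G X = carrier G"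
    and "subgroup H G"
    and "\<forall>x\<in>X. \<exists>k::nat. k \<ge> 1 \<and> x [^]\<^bsub>G\<^esub> k \<in> H"
  shows "finite_index_subgroup H G"
proof -
  interpret group G using assms(1) by (simp add: nilpotent_group_def)
  show ?thesis
    using nilpotent_finite_index[OF assms] finite_cover_imp_finite_rcosets[OF assms(5)] assms(5)
    unfolding finite_index_subgroup_def by blast
qed


section \<open>Injectivity of simple virtual endomorphisms\<close>

section \<open>Simple virtual endomorphisms\<close>

text \<open>\<open>g\<close> and its conjugate by \<open>z\<close> are both \<open>n\<close>-th
  roots of \<open>g [^] n\<close>, hence equal.\<close>

lemma (in group) commutes_if_pow_commutes:
  fixes n :: nat
  assumes roots: "\<And>x y. \<lbrakk>x \<in> carrier G; y \<in> carrier G; x [^] n = y [^] n\<rbrakk> \<Longrightarrow> x = y"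
    and "z \<in> carrier G" "g \<in> carrier G" "z \<otimes> g [^] n = g [^] n \<otimes> z"
  shows "z \<otimes> g = g \<otimes> z"
proof -
  have conj: "(z \<otimes> g \<otimes> inv z) [^] k = z \<otimes> g [^] k \<otimes> inv z" for k :: nat
    by (induction k) (use assms(2,3) in \<open>simp_all add: group_simps\<close>)
  have "(z \<otimes> g \<otimes> inv z) [^] n = g [^] n"
    unfolding conj using assms(2-4) by (simp add: m_assoc)
  then have "z \<otimes> g \<otimes> inv z = g" using roots assms(2,3) by simp
  then have "z \<otimes> g \<otimes> inv z \<otimes> z = g \<otimes> z" by simp
  then show ?thesis using assms(2,3) by (simp add: m_assoc)
qed

text \<open>A nontrivial kernel would meet the centre of \<open>K\<close>, which is central in \<open>G\<close> by uniqueness of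
  roots; a central subgroup of the kernel is normal and \<open>f\<close>-invariant.\<close>

lemma simple_virtual_endomorphism_inj:
  assumes nil: "nilpotent_group G"
    and roots: "\<And>x y (n::nat). \<lbrakk>x \<in> carrier G; y \<in> carrier G; n \<ge> 1; x [^]\<^bsub>G\<^esub> n = y [^]\<^bsub>G\<^esub> n\<rbrakk> \<Longrightarrow> x = y"
    and f: "simple_virtual_endomorphism G K f"
  shows "inj_on f K"
proof -
  interpret group G using nil by (simp add: nilpotent_group_def)
  have vf: "virtual_endomorphism G K f" and core: "f_core G K f = {\<one>\<^bsub>G\<^esub>}"
    using f by (auto simp: simple_virtual_endomorphism_def)
  have Kfin: "finite_index_subgroup K G" and hom: "f \<in> hom (G\<lparr>carrier := K\<rparr>) G"
    using vf by (auto simp: virtual_endomorphism_def)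
  have K: "subgroup K G" using Kfin by (simp add: finite_index_subgroup_def)
  note Kc = subgroup.mem_carrier[OF K]
  interpret K: group "G\<lparr>carrier := K\<rparr>" by (rule subgroup_imp_group[OF K])
  interpret f: group_hom "G\<lparr>carrier := K\<rparr>" G f by unfold_locales (rule hom)
  have fone: "f \<one>\<^bsub>G\<^esub> = \<one>\<^bsub>G\<^esub>" using f.hom_one by simp
  have fm: "f (x \<otimes>\<^bsub>G\<^esub> y) = f x \<otimes>\<^bsub>G\<^esub> f y" if "x \<in> K" "y \<in> K" for x y
    using f.hom_mult[of x y] that by simp
  have fi: "f (inv\<^bsub>G\<^esub> x) = inv\<^bsub>G\<^esub> f x" if "x \<in> K" for x
    using f.hom_inv[of x] that m_inv_consistent[OF K that] by simp
  have fc: "f x \<in> carrier G" if "x \<in> K" for x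
    using f.hom_closed[of x] that by simp
  \<comment> \<open>Centrality is demanded against all of \<open>G\<close>, not just
    \<open>K\<close>, so that \<open>N\<close> is normal in \<open>G\<close>.\<close>
  define N where "N = {x \<in> K. f x = \<one>\<^bsub>G\<^esub> \<and> (\<forall>g\<in>carrier G. x \<otimes>\<^bsub>G\<^esub> g = g \<otimes>\<^bsub>G\<^esub> x)}"
  have Nsub: "subgroup N G"
  proof (rule subgroupI)
    show "N \<subseteq> carrier G" using Kc by (auto simp: N_def)
    show "N \<noteq> {}" using subgroup.one_closed[OF K] fone by (auto simp: N_def intro!: exI[of _ "\<one>\<^bsub>G\<^esub>"])
  next
    fix x assume x: "x \<in> N"
    then have xc: "x \<in> K" "x \<in> carrier G" and fx: "f x = \<one>\<^bsub>G\<^esub>"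
      using Kc unfolding N_def by blast+
    have "inv\<^bsub>G\<^esub> x \<otimes>\<^bsub>G\<^esub> g = g \<otimes>\<^bsub>G\<^esub> inv\<^bsub>G\<^esub> x" if g: "g \<in> carrier G" for g
    proof -
      have "x \<otimes>\<^bsub>G\<^esub> g = g \<otimes>\<^bsub>G\<^esub> x" using x g by (auto simp: N_def)
      then have "inv\<^bsub>G\<^esub> x \<otimes>\<^bsub>G\<^esub> (x \<otimes>\<^bsub>G\<^esub> g) \<otimes>\<^bsub>G\<^esub> inv\<^bsub>G\<^esub> x = inv\<^bsub>G\<^esub> x \<otimes>\<^bsub>G\<^esub> (g \<otimes>\<^bsub>G\<^esub> x) \<otimes>\<^bsub>G\<^esub> inv\<^bsub>G\<^esub> x"
        by simp
      then show ?thesis using xc g by (simp add: group_simps)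
    qed
    moreover have "f (inv\<^bsub>G\<^esub> x) = \<one>\<^bsub>G\<^esub>" using fi[OF xc(1)] fx by simp
    ultimately show "inv\<^bsub>G\<^esub> x \<in> N"
      using subgroup.m_inv_closed[OF K xc(1)] unfolding N_def by blast
  next
    fix x y assume xy: "x \<in> N" "y \<in> N"
    then have c: "x \<in> K" "y \<in> K" "x \<in> carrier G" "y \<in> carrier G"
      and fxy: "f x = \<one>\<^bsub>G\<^esub>" "f y = \<one>\<^bsub>G\<^esub>"
      using Kc unfolding N_def by blast+
    have "x \<otimes>\<^bsub>G\<^esub> y \<otimes>\<^bsub>G\<^esub> g = g \<otimes>\<^bsub>G\<^esub> (x \<otimes>\<^bsub>G\<^esub> y)" if g: "g \<in> carrier G" for g
    proof -
      have "x \<otimes>\<^bsub>G\<^esub> g = g \<otimes>\<^bsub>G\<^esub> x" "y \<otimes>\<^bsub>G\<^esub> g = g \<otimes>\<^bsub>G\<^esub> y" using xy g unfolding N_def by blast+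
      then show ?thesis using c g by (metis m_assoc)
    qed
    moreover have "f (x \<otimes>\<^bsub>G\<^esub> y) = \<one>\<^bsub>G\<^esub>"
      using fm[OF c(1,2)] fxy by simp
    ultimately show "x \<otimes>\<^bsub>G\<^esub> y \<in> N"
      using subgroup.m_closed[OF K c(1,2)] unfolding N_def by blast
  qed
  have "N \<lhd> G"
  proof (rule normal_invI[OF Nsub])
    fix g x assume g: "g \<in> carrier G" and x: "x \<in> N"
    then have "g \<otimes>\<^bsub>G\<^esub> x = x \<otimes>\<^bsub>G\<^esub> g" by (auto simp: N_def)
    then have "g \<otimes>\<^bsub>G\<^esub> x \<otimes>\<^bsub>G\<^esub> inv\<^bsub>G\<^esub> g = x"
      using g subgroup.mem_carrier[OF Nsub x] by (simp add: m_assoc)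
    then show "g \<otimes>\<^bsub>G\<^esub> x \<otimes>\<^bsub>G\<^esub> inv\<^bsub>G\<^esub> g \<in> N" using x by simp
  qed
  moreover have "f ` N \<subseteq> N"
    using subgroup.one_closed[OF Nsub] by (auto simp: N_def)
  ultimately have N1: "N \<subseteq> {\<one>\<^bsub>G\<^esub>}"
    using f_core_greatest(2)[OF is_group vf, of N] core by (auto simp: N_def)
  have "nilpotent_group (G\<lparr>carrier := K\<rparr>)" by (rule nilpotent_group_subgroup[OF nil K])
  then obtain c where c: "lower_central_series (G\<lparr>carrier := K\<rparr>) c = {\<one>\<^bsub>G\<^esub>}"
    by (auto simp: nilpotent_group_def)
  \<comment> \<open>Descending induction along the series of \<open>K\<close>: commutators of
    \<open>x\<close> with \<open>K\<close> are kernel elements of the next term, hence trivial, so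
    \<open>x\<close> commutes with \<open>K\<close>. Every element of \<open>G\<close> has a power
    in \<open>K\<close>, so \<open>x\<close> commutes with \<open>G\<close> and lies in
    \<open>N\<close>.\<close>
  have triv: "x = \<one>\<^bsub>G\<^esub>" if "n \<le> c" "x \<in> lower_central_series (G\<lparr>carrier := K\<rparr>) n" "f x = \<one>\<^bsub>G\<^esub>" for n x
    using that
  proof (induction n arbitrary: x rule: inc_induct)
    case base
    then show ?case using c by auto
  next
    case (step n)
    have xK: "x \<in> K" using K.lower_central_series_in_carrier[OF step.prems(1)] by simp
    have comm: "x \<otimes>\<^bsub>G\<^esub> k = k \<otimes>\<^bsub>G\<^esub> x" if k: "k \<in> K" for k
    proof -
      have "commutator G x k \<in> lower_central_series (G\<lparr>carrier := K\<rparr>) (Suc n)"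
        using K.commutator_in_lower_central_series[OF step.prems(1), of k] k
        by (simp add: commutator_consistent[OF K xK])
      moreover have "f (commutator G x k) = \<one>\<^bsub>G\<^esub>"
        using xK k step.prems(2) fc[OF k]
        by (simp add: commutator_def fm fi subgroup.m_closed[OF K] subgroup.m_inv_closed[OF K])
      ultimately have "commutator G x k = \<one>\<^bsub>G\<^esub>" by (rule step.IH)
      then show ?thesis
        using mult_eq_commutator_mult[OF Kc[OF xK] Kc[OF k]] Kc[OF xK] Kc[OF k] by simp
    qed
    have "x \<otimes>\<^bsub>G\<^esub> g = g \<otimes>\<^bsub>G\<^esub> x" if g: "g \<in> carrier G" for g
    proof -
      obtain n :: nat where n: "n \<ge> 1" "g [^]\<^bsub>G\<^esub> n \<in> K"
        using finite_index_pow_mem[OF Kfin g] by blast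
      show ?thesis
        by (rule commutes_if_pow_commutes[OF roots[OF _ _ n(1)] Kc[OF xK] g comm[OF n(2)]])
    qed
    then have "x \<in> N" using xK step.prems(2) by (auto simp: N_def)
    then show ?case using N1 by auto
  qed
  show ?thesis
  proof (rule inj_onI)
    fix x y assume xy: "x \<in> K" "y \<in> K" "f x = f y"
    have "x \<otimes>\<^bsub>G\<^esub> inv\<^bsub>G\<^esub> y = \<one>\<^bsub>G\<^esub>"
      by (rule triv[of 0])
        (use xy fc in \<open>simp_all add: fm fi subgroup.m_closed[OF K] subgroup.m_inv_closed[OF K]\<close>)
    then show "x = y" using xy(1,2) Kc by (simp add: inv_solve_right')
  qed
qed


section \<open>Kernels of homomorphisms from free groups\<close>

section \<open>Geometric equivalence\<close>

text \<open>Provides generators for the image of the free group, to which the index criterion is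
  applied.\<close>

lemma free_group_generate:
  "generate (free_group X) ((\<lambda>x. [(x, True)]) ` X) = carrier (free_group X)"
proof
  interpret F: group "free_group X" by (rule group_free_group)
  let ?L = "(\<lambda>x. [(x, True)]) ` X"
  have L: "?L \<subseteq> carrier (free_group X)" by (auto simp: free_group_def)
  then show "generate (free_group X) ?L \<subseteq> carrier (free_group X)" by (rule F.generate_incl)
  have letter: "[l] \<in> generate (free_group X) ?L" if l: "fst l \<in> X" for l
  proof (cases "snd l")
    case True
    then have "[l] = [(fst l, True)]" by (simp add: prod_eq_iff)
    then show ?thesis using l by (auto intro: generate.incl)
  next
    case False
    have "[l] = inv\<^bsub>free_group X\<^esub> [(fst l, True)]"
      using False l by (intro F.inv_equality [symmetric]) (auto simp: free_group_def inv_letter_def)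
    then show ?thesis using l by (auto intro: generate.inv)
  qed
  have "fst ` set w \<subseteq> X \<Longrightarrow> reduced w \<Longrightarrow> w \<in> generate (free_group X) ?L" for w
  proof (induction w)
    case Nil
    then show ?case using generate.one[of "free_group X" ?L] by (simp add: free_group_def)
  next
    case (Cons l w)
    have "w \<in> generate (free_group X) ?L"
      using Cons by (auto dest: reduced_ConsD)
    moreover have "l # w = [l] \<otimes>\<^bsub>free_group X\<^esub> w"
      using push_reduced[OF Cons.prems(2)] by (simp add: free_group_def)
    moreover have "[l] \<in> generate (free_group X) ?L" using letter Cons.prems(1) by simp
    ultimately show ?case by (simp only: generate.eng)
  qed
  then show "carrier (free_group X) \<subseteq> generate (free_group X) ?L"
    by (auto simp: free_group_def)
qed

text \<open>Every kernel intersected in the closure over \<open>M\<close> is also intersected in the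
  one over \<open>G\<close>.\<close>

lemma G_closure_subset:
  assumes "\<And>\<sigma>. \<sigma> \<in> hom F M \<Longrightarrow> \<exists>\<tau> \<in> hom F G. kernel F G \<tau> = kernel F M \<sigma>"
  shows "G_closure F G S \<subseteq> G_closure F M S"
  unfolding G_closure_def annihilating_homs_def
proof safe
  fix x \<sigma>
  assume x: "x \<in> \<Inter> (kernel F G ` {\<sigma> \<in> hom F G. S \<subseteq> kernel F G \<sigma>})"
    and \<sigma>: "\<sigma> \<in> hom F M" "S \<subseteq> kernel F M \<sigma>"
  obtain \<tau> where "\<tau> \<in> hom F G" "kernel F G \<tau> = kernel F M \<sigma>" using assms[OF \<sigma>(1)] by blast
  then show "x \<in> kernel F M \<sigma>" using x \<sigma>(2) by auto
qed

lemma DirProd_nat_pow: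
  "(a, b) [^]\<^bsub>G \<times>\<times> H\<^esub> (n::nat) = (a [^]\<^bsub>G\<^esub> n, b [^]\<^bsub>H\<^esub> n)"
  by (induction n) simp_all

text \<open>The product of the individual exponents is a multiple of each of them.\<close>

lemma (in group) common_power_mem:
  assumes D: "subgroup D G" and "finite I"
    and a: "\<And>i. i \<in> I \<Longrightarrow> a i \<in> carrier G"
    and pow: "\<And>i. i \<in> I \<Longrightarrow> \<exists>n::nat. n \<ge> 1 \<and> a i [^] n \<in> D"
  shows "\<exists>q::nat. q \<ge> 1 \<and> (\<forall>i\<in>I. a i [^] q \<in> D)"
proof -
  obtain n :: "_ \<Rightarrow> nat" where n: "\<And>i. i \<in> I \<Longrightarrow> n i \<ge> 1 \<and> a i [^] n i \<in> D"
    using pow by metis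
  have "a i [^] (\<Prod>i\<in>I. n i) \<in> D" if i: "i \<in> I" for i
  proof -
    have "(\<Prod>i\<in>I. n i) = n i * (\<Prod>j\<in>I - {i}. n j)" using \<open>finite I\<close> i by (simp add: prod.remove)
    then show ?thesis
      using subgroup_int_pow_closed[OF D, of "a i [^] n i" "int (\<Prod>j\<in>I - {i}. n j)"] n[OF i] a[OF i]
      by (simp only: int_pow_int nat_pow_pow)
  qed
  moreover have "(\<Prod>i\<in>I. n i) \<ge> 1" using n by (intro prod_ge_1) auto
  ultimately show ?thesis by blast
qed

lemma hom_lift_same_kernel:
  fixes G :: "('a, 'm) monoid_scheme" and M :: "('b, 'n) monoid_scheme" and n :: nat
  assumes fg: "finitely_generated G" and nilG: "nilpotent_group G"
    and tfG: "torsion_free G" and sim: "strongly_recurrent_self_similar G"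
    and mc: "malcev_completion G M"
    and \<sigma>: "\<sigma> \<in> hom (free_group {..<n}) M"
  shows "\<exists>\<tau> \<in> hom (free_group {..<n}) G.
    kernel (free_group {..<n}) G \<tau> = kernel (free_group {..<n}) M \<sigma>"
proof -
  let ?F = "free_group {..<n}"
  have nilM: "nilpotent_group M" and tfM: "torsion_free M"
    and rootsM: "\<And>x n. \<lbrakk>x \<in> carrier M; n \<ge> (1::nat)\<rbrakk> \<Longrightarrow> \<exists>!y. y \<in> carrier M \<and> y [^]\<^bsub>M\<^esub> n = x"
    using mc by (auto simp: malcev_completion_def)
  obtain \<iota> where \<iota>: "\<iota> \<in> hom G M" "inj_on \<iota> (carrier G)"
    and powM: "\<And>x. x \<in> carrier M \<Longrightarrow> \<exists>n::nat. n \<ge> 1 \<and> x [^]\<^bsub>M\<^esub> n \<in> \<iota> ` carrier G"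
    using mc unfolding malcev_completion_def mon_def by blast
  interpret G: group G using nilG by (simp add: nilpotent_group_def)
  interpret M: group M using nilM by (simp add: nilpotent_group_def)
  interpret F: group ?F by (rule group_free_group)
  interpret \<iota>: group_hom G M \<iota> by unfold_locales (rule \<iota>(1))
  interpret \<sigma>: group_hom ?F M \<sigma> by unfold_locales (rule \<sigma>)
  \<comment> \<open>Uniqueness of roots in \<open>G\<close> is inherited from \<open>M\<close>
    through the injection \<open>\<iota>\<close>.\<close>
  have rootsG: "x = y" if "x \<in> carrier G" "y \<in> carrier G" "k \<ge> 1" "x [^]\<^bsub>G\<^esub> k = y [^]\<^bsub>G\<^esub> k" for x y and k :: nat
  proof -
    have "\<iota> x [^]\<^bsub>M\<^esub> k = \<iota> y [^]\<^bsub>M\<^esub> k"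
      using \<iota>.hom_nat_pow[OF that(1), of k] \<iota>.hom_nat_pow[OF that(2), of k] that(4) by simp
    moreover have "\<iota> x \<in> carrier M" "\<iota> y \<in> carrier M" using that(1,2) by simp_all
    ultimately have "\<iota> x = \<iota> y"
      using rootsM[OF M.nat_pow_closed that(3), of "\<iota> y" k] by blast
    then show ?thesis using \<iota>(2) that by (simp add: inj_on_def)
  qed
  define a where "a i = \<sigma> [(i, True)]" for i
  have letter: "[(i, True)] \<in> carrier ?F" if "i < n" for i using that by (simp add: free_group_def)
  have ac: "a i \<in> carrier M" if "i < n" for i using letter[OF that] by (simp add: a_def)
  have \<iota>G: "subgroup (\<iota> ` carrier G) M" by (rule \<iota>.subgroup_img_is_subgroup[OF G.subgroup_self])
  obtain q :: nat where q: "q \<ge> 1" "\<And>i. i < n \<Longrightarrow> a i [^]\<^bsub>M\<^esub> q \<in> \<iota> ` carrier G"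
    using M.common_power_mem[OF \<iota>G, of "{..<n}" a] powM ac by auto
  obtain c where c: "lower_central_series G c = {\<one>\<^bsub>G\<^esub>}"
    using nilG by (auto simp: nilpotent_group_def)
  \<comment> \<open>The exponent is \<open>q ^ c\<close> because term \<open>c\<close> is trivial: a
    \<open>q\<close>-th root modulo term \<open>c\<close> is then a genuine root.\<close>
  define H where "H = generate G {g [^]\<^bsub>G\<^esub> (q ^ c) | g. g \<in> carrier G}"
  have H: "subgroup H G" unfolding H_def by (rule G.generate_is_subgroup) auto
  obtain X where X: "finite X" "X \<subseteq> carrier G" "generate G X = carrier G"
    using fg by (auto simp: finitely_generated_def)
  have "\<exists>k::nat. k \<ge> 1 \<and> x [^]\<^bsub>G\<^esub> k \<in> H" if "x \<in> X" for x
    unfolding H_def using that X(2) q(1) by (intro exI[of _ "q ^ c"]) (auto intro: generate.incl)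
  then have "finite_index_subgroup H G"
    by (intro nilpotent_finite_index_subgroup[OF nilG X H]) blast
  then obtain K f where KH: "finite_index_subgroup K (G\<lparr>carrier := H\<rparr>)"
    and sf: "simple_virtual_endomorphism G K f" and rf: "recurrent_virtual_endomorphism G K f"
    using sim unfolding strongly_recurrent_self_similar_def by blast
  have KsubH: "K \<subseteq> H"
    using KH subgroup.subset[of K "G\<lparr>carrier := H\<rparr>"] by (simp add: finite_index_subgroup_def)
  have K: "subgroup K G" and fhom: "f \<in> hom (G\<lparr>carrier := K\<rparr>) G" and fsurj: "f ` K = carrier G"
    using rf by (auto simp: recurrent_virtual_endomorphism_def virtual_endomorphism_def
        finite_index_subgroup_def)
  interpret K: group "G\<lparr>carrier := K\<rparr>" by (rule G.subgroup_imp_group[OF K])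
  interpret f: group_hom "G\<lparr>carrier := K\<rparr>" G f by unfold_locales (rule fhom)
  have finj: "inj_on f K" by (rule simple_virtual_endomorphism_inj[OF nilG rootsG sf])
  have "\<exists>y \<in> carrier G. y [^]\<^bsub>G\<^esub> q \<in> K \<and> \<iota> (f (y [^]\<^bsub>G\<^esub> q)) = a i [^]\<^bsub>M\<^esub> q" if i: "i < n" for i
  proof -
    obtain k where k: "k \<in> K" "\<iota> (f k) = a i [^]\<^bsub>M\<^esub> q"
      using q(2)[OF i] fsurj by (metis imageE)
    \<comment> \<open>\<open>k\<close> lies in \<open>K\<close> and hence in \<open>H\<close>;
      cosets of the trivial term are single elements.\<close>
    obtain y where y: "y \<in> carrier G" "{\<one>\<^bsub>G\<^esub>} #>\<^bsub>G\<^esub> k = {\<one>\<^bsub>G\<^esub>} #>\<^bsub>G\<^esub> (y [^]\<^bsub>G\<^esub> q)"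
      using generate_pow_root[OF G.is_group, of k q c] k(1) KsubH c unfolding H_def by auto
    have "k = y [^]\<^bsub>G\<^esub> q"
      using y subgroup.mem_carrier[OF K k(1)] by (simp add: r_coset_def)
    then show ?thesis using y(1) k by auto
  qed
  then obtain y where y: "\<And>i. i < n \<Longrightarrow> y i \<in> carrier G" "\<And>i. i < n \<Longrightarrow> y i [^]\<^bsub>G\<^esub> q \<in> K"
    "\<And>i. i < n \<Longrightarrow> \<iota> (f (y i [^]\<^bsub>G\<^esub> q)) = a i [^]\<^bsub>M\<^esub> q"
    by metis
  obtain \<tau> where \<tau>: "\<tau> \<in> hom ?F G" "\<And>i. i < n \<Longrightarrow> \<tau> [(i, True)] = y i"
    using free_group_universal(1)[OF G.is_group, of y "{..<n}"] y(1) by auto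
  interpret \<tau>: group_hom ?F G \<tau> by unfold_locales (rule \<tau>(1))
  interpret R: group "M \<times>\<times> G" by (rule DirProd_group[OF M.is_group G.is_group])
  interpret \<rho>: group_hom ?F "M \<times>\<times> G" "\<lambda>w. (\<sigma> w, \<tau> w)"
    by unfold_locales (simp add: hom_paired \<sigma> \<tau>(1))
  interpret \<gamma>: group_hom "G\<lparr>carrier := K\<rparr>" "M \<times>\<times> G" "\<lambda>k. (\<iota> (f k), k)"
  proof unfold_locales
    have "(\<lambda>k. \<iota> (f k)) \<in> hom (G\<lparr>carrier := K\<rparr>) M"
      using hom_compose[OF fhom \<iota>(1)] by (simp add: comp_def)
    moreover have "(\<lambda>k. k) \<in> hom (G\<lparr>carrier := K\<rparr>) G"
      using subgroup.mem_carrier[OF K] by (auto simp: hom_def)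
    ultimately show "(\<lambda>k. (\<iota> (f k), k)) \<in> hom (G\<lparr>carrier := K\<rparr>) (M \<times>\<times> G)"
      by (simp add: hom_paired)
  qed
  \<comment> \<open>The graph carries its argument in the second coordinate, to match the pairs
    \<open>(\<sigma> w, \<tau> w)\<close>.\<close>
  define \<Gamma> where "\<Gamma> = (\<lambda>k. (\<iota> (f k), k)) ` K"
  have \<Gamma>: "subgroup \<Gamma> (M \<times>\<times> G)"
    using \<gamma>.subgroup_img_is_subgroup[OF K.subgroup_self] by (simp add: \<Gamma>_def)
  \<comment> \<open>The index argument takes place inside the image of the free group, which is
    generated by the finite set \<open>Y\<close> of images of letters.\<close>
  define P where "P = (\<lambda>w. (\<sigma> w, \<tau> w)) ` carrier ?F"
  have P: "subgroup P (M \<times>\<times> G)"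
    unfolding P_def by (rule \<rho>.subgroup_img_is_subgroup[OF F.subgroup_self])
  define Y where "Y = (\<lambda>w. (\<sigma> w, \<tau> w)) ` (\<lambda>i. [(i, True)]) ` {..<n}"
  have YP: "Y \<subseteq> P" using letter by (auto simp: Y_def P_def)
  have "generate (M \<times>\<times> G) Y = P"
    unfolding Y_def P_def using letter
    by (subst \<rho>.generate_img) (auto simp only: free_group_generate lessThan_iff)
  then have Ygen: "generate ((M \<times>\<times> G)\<lparr>carrier := P\<rparr>) Y = carrier ((M \<times>\<times> G)\<lparr>carrier := P\<rparr>)"
    using R.generate_consistent[OF YP P] by simp
  have Ypow: "\<exists>k::nat. k \<ge> 1 \<and> z [^]\<^bsub>(M \<times>\<times> G)\<lparr>carrier := P\<rparr>\<^esub> k \<in> \<Gamma> \<inter> P" if z: "z \<in> Y" for z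
  proof -
    obtain i where i: "i < n" "z = (a i, y i)" using z by (auto simp: Y_def a_def \<tau>(2))
    have "z [^]\<^bsub>M \<times>\<times> G\<^esub> q = (\<iota> (f (y i [^]\<^bsub>G\<^esub> q)), y i [^]\<^bsub>G\<^esub> q)"
      by (simp add: i(2) DirProd_nat_pow y(3)[OF i(1)])
    then have "z [^]\<^bsub>M \<times>\<times> G\<^esub> q \<in> \<Gamma>" using y(2)[OF i(1)] by (auto simp: \<Gamma>_def)
    moreover have "z [^]\<^bsub>M \<times>\<times> G\<^esub> q \<in> P"
      using R.subgroup_int_pow_closed[OF P, of z "int q"] z YP by (auto simp: int_pow_int)
    ultimately show ?thesis using q(1) by (auto simp flip: R.nat_pow_consistent)
  qed
  have fin: "finite_index_subgroup (\<Gamma> \<inter> P) ((M \<times>\<times> G)\<lparr>carrier := P\<rparr>)"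
  proof (rule nilpotent_finite_index_subgroup[of _ Y])
    show "nilpotent_group ((M \<times>\<times> G)\<lparr>carrier := P\<rparr>)"
      by (rule nilpotent_group_subgroup[OF nilpotent_group_DirProd[OF nilM nilG] P])
    show "subgroup (\<Gamma> \<inter> P) ((M \<times>\<times> G)\<lparr>carrier := P\<rparr>)"
      by (rule R.subgroup_incl[OF R.subgroups_Inter_pair[OF \<Gamma> P] P]) simp
  qed (use Ygen YP Ypow in \<open>auto simp: Y_def\<close>)
  interpret P: group "(M \<times>\<times> G)\<lparr>carrier := P\<rparr>" by (rule R.subgroup_imp_group[OF P])
  have "\<tau> w = \<one>\<^bsub>G\<^esub> \<longleftrightarrow> \<sigma> w = \<one>\<^bsub>M\<^esub>" if w: "w \<in> carrier ?F" for w
  proof -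
    have sc: "\<sigma> w \<in> carrier M" "\<tau> w \<in> carrier G" using w by auto
    have "(\<sigma> w, \<tau> w) \<in> carrier ((M \<times>\<times> G)\<lparr>carrier := P\<rparr>)" using w by (auto simp: P_def)
    from P.finite_index_pow_mem[OF fin this] obtain k :: nat
      where k: "k \<ge> 1" "(\<sigma> w [^]\<^bsub>M\<^esub> k, \<tau> w [^]\<^bsub>G\<^esub> k) \<in> \<Gamma>"
      by (auto simp: DirProd_nat_pow simp flip: R.nat_pow_consistent)
    then have \<kappa>: "\<tau> w [^]\<^bsub>G\<^esub> k \<in> K" "\<sigma> w [^]\<^bsub>M\<^esub> k = \<iota> (f (\<tau> w [^]\<^bsub>G\<^esub> k))" by (auto simp: \<Gamma>_def)
    have one: "\<one>\<^bsub>G\<^esub> \<in> K" "f \<one>\<^bsub>G\<^esub> = \<one>\<^bsub>G\<^esub>" "\<iota> \<one>\<^bsub>G\<^esub> = \<one>\<^bsub>M\<^esub>"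
      using subgroup.one_closed[OF K] f.hom_one \<iota>.hom_one by simp_all
    \<comment> \<open>Torsion-freeness trades elements for their \<open>k\<close>-th powers at both
      ends; in between, membership in the graph and injectivity of \<open>f\<close> and
      \<open>\<iota>\<close> keep every link an equivalence.\<close>
    have "\<tau> w = \<one>\<^bsub>G\<^esub> \<longleftrightarrow> \<tau> w [^]\<^bsub>G\<^esub> k = \<one>\<^bsub>G\<^esub>"
      using tfG k(1) sc by (auto simp: torsion_free_def)
    also have "\<dots> \<longleftrightarrow> f (\<tau> w [^]\<^bsub>G\<^esub> k) = f \<one>\<^bsub>G\<^esub>"
      using inj_on_eq_iff[OF finj \<kappa>(1) one(1)] by simp
    also have "\<dots> \<longleftrightarrow> \<iota> (f (\<tau> w [^]\<^bsub>G\<^esub> k)) = \<iota> \<one>\<^bsub>G\<^esub>"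
      using inj_on_eq_iff[OF \<iota>(2), of "f (\<tau> w [^]\<^bsub>G\<^esub> k)" "\<one>\<^bsub>G\<^esub>"] f.hom_closed[of "\<tau> w [^]\<^bsub>G\<^esub> k"] \<kappa>(1) one
      by simp
    also have "\<dots> \<longleftrightarrow> \<sigma> w [^]\<^bsub>M\<^esub> k = \<one>\<^bsub>M\<^esub>" using \<kappa>(2) one by simp
    also have "\<dots> \<longleftrightarrow> \<sigma> w = \<one>\<^bsub>M\<^esub>"
      using tfM k(1) sc by (auto simp: torsion_free_def)
    finally show ?thesis .
  qed
  then have "kernel ?F G \<tau> = kernel ?F M \<sigma>" by (auto simp: kernel_def)
  then show ?thesis using \<tau>(1) by blast
qed

theorem theoremC:
  fixes G :: "('a, 'm) monoid_scheme" and M :: "('b, 'n) monoid_scheme"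
  assumes "group G"
    and "finitely_generated G"
    and "torsion_free G"
    and "nilpotent_group G"
    and "strongly_recurrent_self_similar G"
    and "malcev_completion G M"
  shows "geometrically_equivalent G M"
proof -
  obtain \<iota> where \<iota>: "\<iota> \<in> hom G M" "inj_on \<iota> (carrier G)"
    using assms(6) unfolding malcev_completion_def mon_def by blast
  interpret \<iota>: group_hom G M \<iota>
    using assms(1,6) \<iota>(1)
    by (simp add: group_hom_def group_hom_axioms_def malcev_completion_def nilpotent_group_def)
  \<comment> \<open>The closure operators themselves coincide: one inclusion uses the lifts to
    \<open>G\<close>, the other composition with the embedding.\<close>
  have "G_closure (free_group {..<n}) G S = G_closure (free_group {..<n}) M S" for n :: nat and S
  proof
    show "G_closure (free_group {..<n}) G S \<subseteq> G_closure (free_group {..<n}) M S"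
      by (rule G_closure_subset) (rule hom_lift_same_kernel[OF assms(2,4,3,5,6)])
    show "G_closure (free_group {..<n}) M S \<subseteq> G_closure (free_group {..<n}) G S"
    proof (rule G_closure_subset)
      fix \<tau> assume \<tau>: "\<tau> \<in> hom (free_group {..<n}) G"
      have "\<iota> (\<tau> w) = \<one>\<^bsub>M\<^esub> \<longleftrightarrow> \<tau> w = \<one>\<^bsub>G\<^esub>" if "w \<in> carrier (free_group {..<n})" for w
        using inj_on_eq_iff[OF \<iota>(2) hom_in_carrier[OF \<tau> that] \<iota>.G.one_closed] by simp
      then have "kernel (free_group {..<n}) M (\<iota> \<circ> \<tau>) = kernel (free_group {..<n}) G \<tau>"
        by (auto simp: kernel_def)
      then show "\<exists>\<sigma> \<in> hom (free_group {..<n}) M.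
          kernel (free_group {..<n}) M \<sigma> = kernel (free_group {..<n}) G \<tau>"
        using hom_compose[OF \<tau> \<iota>(1)] by blast
    qed
  qed
  then show ?thesis by (simp add: geometrically_equivalent_def G_closed_def)
qed

end
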